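(* Let $m,p\in\mathbb N$, $\omega>0$, and let $\theta=\{\theta_k\}_{k\in\mathbb Z}\in\mathcal S(p,\omega)$. Consider the quasilinear impulsive system $$x'(t)=Ax(t)+f(t,x(t))+g_1(t)+g_2(t),\quad t\neq\theta_k,$$ $$\Delta x\big|_{t=\theta_k}=Bx(\theta_k)+h(x(\theta_k))+\gamma_k,\quad k\in\mathbb Z, \qquad (\ast)$$ where $A,B\in\mathbb R^{m\times m}$ are constant commuting matrices; $f:\mathbb R\times\mathbb R^m\to\mathbb R^m$ and $h:\mathbb R^m\to\mathbb R^m$ are continuous in all their arguments; $\{\gamma_k\}_{k\in\mathbb Z}$ is a bounded sequence in $\mathbb R^m$ with $\lim_{k\to\infty}\|\gamma_k\|=0$; $g_1\in\mathcal{BPC}(\theta)$ is given by $g_1(t)=\sigma_k$ for $\theta_{kp}<t\le\theta_{(k+1)p}$, $k\in\mathbb Z$, with $\{\sigma_k\}_{k\in\mathbb Z}$ a bounded sequence in $\mathbb R^m$; and $g_2\in\mathcal{BPC}(\theta)$ satisfies $\lim_{t\to\infty}\|g_2(t)\|=0$. Suppose that the following assumptions hold. (1) $\det(I+B)\ne 0$, where $I$ is the $m\times m$ identity matrix. (2) The real parts of all eigenvalues of $A+\frac{p}{\omega}\mathrm{Log}(I+B)$ are negative. (3) $f(t+\omega,x)=f(t,x)$ for all $(t,x)\in\mathbb R\times\mathbb R^m$. (4) There are positive numbers $M_f,M_h$ with $\sup_{(t,x)\in[0,\omega)\times\mathbb R^m}\|f(t,x)\|\le M_f$ and $\sup_{x\in\mathbb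 R^m}\|h(x)\|\le M_h$. (5) There are positive numbers $L_f,L_h$ with $\|f(t,x_1)-f(t,x_2)\|\le L_f\|x_1-x_2\|$ for all $t\in\mathbb R$, $x_1,x_2\in\mathbb R^m$, and $\|h(x_1)-h(x_2)\|\le L_h\|x_1-x_2\|$ for all $x_1,x_2\in\mathbb R^m$. Let $N\ge1$ and $\lambda>0$ be numbers such that the matriciant $U(t,s)$ of the linear homogeneous system $x'(t)=Ax(t)$ $(t\ne\theta_k)$, $\Delta x|_{t=\theta_k}=Bx(\theta_k)$ satisfies $\|U(t,s)\|\le Ne^{-\lambda(t-s)}$ for all $t\ge s$ (such numbers exist under (1) and (2)), and suppose further that (6) $N\left(\frac{L_f}{\lambda}+\frac{pL_h}{1-e^{-\lambda\omega}}\right)<1$; (7) $NL_f+\frac{p}{\omega}\ln(1+NL_h)<\lambda$; (8) $L_h\|(I+B)^{-1}\|<1$. If the sequence $\{\sigma_k\}_{k\in\mathbb Z}$ is asymptotically unpredictable, then the impulsive system $(\ast)$ possesses a unique asymptotically unpredictable solution. Moreover, this solution is asymptotically stable.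
   Context: Vectors carry the Euclidean norm and square matrices the spectral norm. $\mathcal S(p,\omega)$ is the set of strictly increasing real sequences $\theta=\{\theta_k\}_{k\in\mathbb Z}$ with $\theta_{k+p}=\theta_k+\omega$ for all $k\in\mathbb Z$ ($p\in\mathbb N$, $\omega>0$). $\mathcal{BPC}(\theta)$ is the set of bounded functions $\varphi:\mathbb R\to\mathbb R^m$ such that for each $k\in\mathbb Z$: $\varphi$ is continuous on $(\theta_{k-1},\theta_k)$, the right limit $\varphi(\theta_k+)=\lim_{t\to\theta_k^+}\varphi(t)$ exists, and $\varphi(\theta_k)=\lim_{t\to\theta_k^-}\varphi(t)$. $\Delta x|_{t=\theta_k}=x(\theta_k+)-x(\theta_k)$, where $x(\theta_k+)=\lim_{t\to\theta_k^+}x(t)$. $\mathrm{Log}$ denotes the matrix logarithm. For an interval $J$, $i(J)$ is the number of terms of $\theta$ in $J$. The matriciant is $U(t,s)=e^{A(t-s)}(I+B)^{i([s,t))}$ for $t>s$ and $U(s,s)=I$. Unpredictable function: $\psi\in\mathcal{BPC}(\theta)$, with $\theta\in\mathcal S(p,\omega)$, is unpredictable if there exist positive numbers $\varepsilon_0,\nu$ and real sequences $\{\mu_n\}_{n\in\mathbb N}$, $\{\tau_n\}_{n\in\mathbb N}$, both diverging to infinity, such that (i) for every $\varepsilon>0$ there is $\delta>0$ with $\|\psi(s_1)-\psi(s_2)\|<\varepsilon$ whenever $s_1,s_2$ belong to the same interval of continuity (one of the intervals determined by consecutive $\theta_{k-1},\theta_k$) and $|s_1-s_2|<\delta$; (ii)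 $\|\psi(t+\mu_n)-\psi(t)\|\to0$ as $n\to\infty$ uniformly on compact subsets of $\mathbb R$; (iii) $\|\psi(t+\mu_n)-\psi(t)\|\ge\varepsilon_0$ for each $t\in[\tau_n-\nu,\tau_n+\nu]$ and $n\in\mathbb N$. Asymptotically unpredictable function: $\phi\in\mathcal{BPC}(\theta)$, with $\theta\in\mathcal S(p,\omega)$, is asymptotically unpredictable if $\phi(t)=\psi(t)+\xi(t)$ for all $t\in\mathbb R$, for some unpredictable $\psi\in\mathcal{BPC}(\theta)$ and some $\xi\in\mathcal{BPC}(\theta)$ with $\|\xi(t)\|\to0$ as $t\to\infty$. Unpredictable sequence: a bounded sequence $\{\alpha_k\}_{k\in\mathbb Z}$ in $\mathbb R^m$ is unpredictable if there exist $\upsilon_0>0$ and sequences $\{q_n\}_{n\in\mathbb N},\{r_n\}_{n\in\mathbb N}$ of positive integers, both diverging to infinity, such that $\|\alpha_{k+q_n}-\alpha_k\|\to0$ as $n\to\infty$ for each $k$ in bounded intervals of integers and $\|\alpha_{q_n+r_n}-\alpha_{r_n}\|\ge\upsilon_0$ for each $n\in\mathbb N$. Asymptotically unpredictable sequence: a bounded sequence $\{\sigma_k\}_{k\in\mathbb Z}$ in $\mathbb R^m$ is asymptotically unpredictable if $\sigma_k=\alpha_k+\beta_k$ for all $k\in\mathbb Z$, where $\{\alpha_k\}_{k\in\mathbb Z}$ is unpredictable and $\lim_{k\to\infty}\|\beta_k\|=0$. *)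

theory Defs
  imports "HOL-Analysis.Analysis"
begin

section \<open>Matrices\<close>

text \<open>The multiplication and the norm that the library puts on the type of square matrices are the
  componentwise product and the Frobenius norm, so powers, exponential and spectral norm are
  introduced here from \<open>**\<close> and \<open>*v\<close>.\<close>

definition spectral_norm :: "real^'n^'n \<Rightarrow> real" where
  "spectral_norm M = onorm (\<lambda>v. M *v v)"

primrec matrix_power :: "'a::semiring_1^'n^'n \<Rightarrow> nat \<Rightarrow> 'a^'n^'n" where
  "matrix_power M 0 = mat 1"
| "matrix_power M (Suc n) = M ** matrix_power M n"

definition matrix_exp :: "'a::real_normed_field^'n^'n \<Rightarrow> 'a^'n^'n" where
  "matrix_exp M = (\<Sum>n. inverse (fact n) *\<^sub>R matrix_power M n)"

definition eigenvalue :: "complex^'n^'n \<Rightarrow> complex \<Rightarrow> bool" where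
  "eigenvalue M z \<longleftrightarrow> (\<exists>v. v \<noteq> 0 \<and> M *v v = z *s v)"

definition complex_matrix :: "real^'n^'n \<Rightarrow> complex^'n^'n" where
  "complex_matrix M = map_matrix complex_of_real M"

text \<open>Principal logarithm: every invertible complex matrix has exactly one logarithm whose spectrum
  lies in the strip \<open>- pi < Im z \<le> pi\<close>; it is a polynomial in the matrix. On a singular matrix the
  value is unspecified. For a real matrix with negative eigenvalues it need not be real.\<close>

definition matrix_Log :: "complex^'n^'n \<Rightarrow> complex^'n^'n" where
  "matrix_Log M =
     (THE L. matrix_exp L = M \<and> (\<forall>z. eigenvalue L z \<longrightarrow> - pi < Im z \<and> Im z \<le> pi))"

section \<open>Impulse moments and piecewise continuous functions\<close>

definition impulse_moments :: "nat \<Rightarrow> real \<Rightarrow> (int \<Rightarrow> real) set" where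
  "impulse_moments p \<omega> = {\<theta>. strict_mono \<theta> \<and> (\<forall>k. \<theta> (k + int p) = \<theta> k + \<omega>)}"

definition BPC :: "(int \<Rightarrow> real) \<Rightarrow> (real \<Rightarrow> real^'m) set" where
  "BPC \<theta> = {\<phi>. bounded (range \<phi>) \<and>
     (\<forall>k. continuous_on {\<theta> (k - 1)<..<\<theta> k} \<phi> \<and>
          (\<exists>r. (\<phi> \<longlongrightarrow> r) (at_right (\<theta> k))) \<and>
          (\<phi> \<longlongrightarrow> \<phi> (\<theta> k)) (at_left (\<theta> k)))}"

definition moments_in :: "(int \<Rightarrow> real) \<Rightarrow> real set \<Rightarrow> nat" where
  "moments_in \<theta> J = card {k. \<theta> k \<in> J}"

text \<open>Only the values for \<open>s \<le> t\<close> are meaningful.\<close>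

definition matriciant ::
  "real^'m^'m \<Rightarrow> real^'m^'m \<Rightarrow> (int \<Rightarrow> real) \<Rightarrow> real \<Rightarrow> real \<Rightarrow> real^'m^'m" where
  "matriciant A B \<theta> t s =
     (if s < t
      then matrix_exp ((t - s) *\<^sub>R A) ** matrix_power (mat 1 + B) (moments_in \<theta> {s..<t})
      else mat 1)"

section \<open>Unpredictable functions and sequences\<close>

text \<open>As functions in \<open>BPC \<theta>\<close> are left continuous, their intervals of continuity are the intervals
  \<open>{\<theta> (k - 1)<..\<theta> k}\<close>.\<close>

definition unpredictable :: "(int \<Rightarrow> real) \<Rightarrow> (real \<Rightarrow> real^'m) \<Rightarrow> bool" where
  "unpredictable \<theta> \<psi> \<longleftrightarrow> \<psi> \<in> BPC \<theta> \<and>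
     (\<exists>\<epsilon>\<^sub>0 \<nu> \<mu> \<tau>. \<epsilon>\<^sub>0 > 0 \<and> \<nu> > 0 \<and>
        filterlim \<mu> at_top sequentially \<and> filterlim \<tau> at_top sequentially \<and>
        (\<forall>\<epsilon>>0. \<exists>\<delta>>0. \<forall>k. \<forall>s\<^sub>1\<in>{\<theta> (k - 1)<..\<theta> k}. \<forall>s\<^sub>2\<in>{\<theta> (k - 1)<..\<theta> k}.
            \<bar>s\<^sub>1 - s\<^sub>2\<bar> < \<delta> \<longrightarrow> norm (\<psi> s\<^sub>1 - \<psi> s\<^sub>2) < \<epsilon>) \<and>
        (\<forall>K. compact K \<longrightarrow> uniform_limit K (\<lambda>n t. \<psi> (t + \<mu> n)) \<psi> sequentially) \<and>
        (\<forall>n::nat. \<forall>t\<in>{\<tau> n - \<nu>..\<tau> n + \<nu>}. norm (\<psi> (t + \<mu> n) - \<psi> t) \<ge> \<epsilon>\<^sub>0))"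

definition asymptotically_unpredictable :: "(int \<Rightarrow> real) \<Rightarrow> (real \<Rightarrow> real^'m) \<Rightarrow> bool" where
  "asymptotically_unpredictable \<theta> \<phi> \<longleftrightarrow> \<phi> \<in> BPC \<theta> \<and>
     (\<exists>\<psi> \<xi>. unpredictable \<theta> \<psi> \<and> \<xi> \<in> BPC \<theta> \<and> ((\<lambda>t. norm (\<xi> t)) \<longlongrightarrow> 0) at_top \<and>
        (\<forall>t. \<phi> t = \<psi> t + \<xi> t))"

definition unpredictable_seq :: "(int \<Rightarrow> real^'m) \<Rightarrow> bool" where
  "unpredictable_seq \<alpha> \<longleftrightarrow> bounded (range \<alpha>) \<and>
     (\<exists>\<upsilon>\<^sub>0 (q :: nat \<Rightarrow> int) (r :: nat \<Rightarrow> int). \<upsilon>\<^sub>0 > 0 \<and> (\<forall>n. q n > 0 \<and> r n > 0) \<and>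
        filterlim q at_top sequentially \<and> filterlim r at_top sequentially \<and>
        (\<forall>a b. \<forall>k\<in>{a..b}. (\<lambda>n. norm (\<alpha> (k + q n) - \<alpha> k)) \<longlonglongrightarrow> 0) \<and>
        (\<forall>n. norm (\<alpha> (q n + r n) - \<alpha> (r n)) \<ge> \<upsilon>\<^sub>0))"

definition asymptotically_unpredictable_seq :: "(int \<Rightarrow> real^'m) \<Rightarrow> bool" where
  "asymptotically_unpredictable_seq \<sigma> \<longleftrightarrow> bounded (range \<sigma>) \<and>
     (\<exists>\<alpha> \<beta>. unpredictable_seq \<alpha> \<and> ((\<lambda>k. norm (\<beta> k)) \<longlongrightarrow> 0) at_top \<and>
        (\<forall>k. \<sigma> k = \<alpha> k + \<beta> k))"

section \<open>Impulsive systems\<close>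

text \<open>\<open>x\<close> solves \<open>x'(t) = F t (x t)\<close> for \<open>t \<noteq> \<theta> k\<close>, with jump \<open>G k (x (\<theta> k))\<close> at \<open>t = \<theta> k\<close>, on the
  interval \<open>J\<close>, which will be the whole line or a half-line \<open>{t\<^sub>0..}\<close>. If \<open>t\<^sub>0 = \<theta> k\<close>, the left limit
  condition at \<open>t\<^sub>0\<close> is void (its filter is trivial) and the jump at \<open>t\<^sub>0\<close> is carried out, in accordance
  with the count over \<open>{s..<t}\<close> in the matriciant. If \<open>t\<^sub>0\<close> is no impulse moment, the derivative at \<open>t\<^sub>0\<close>
  is the one-sided one.\<close>

definition impulsive_solution_on ::
  "real set \<Rightarrow> (int \<Rightarrow> real) \<Rightarrow> (real \<Rightarrow> real^'m \<Rightarrow> real^'m) \<Rightarrow> (int \<Rightarrow> real^'m \<Rightarrow> real^'m)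
   \<Rightarrow> (real \<Rightarrow> real^'m) \<Rightarrow> bool" where
  "impulsive_solution_on J \<theta> F G x \<longleftrightarrow>
     (\<forall>t\<in>J. t \<notin> range \<theta> \<longrightarrow> (x has_vector_derivative F t (x t)) (at t within J)) \<and>
     (\<forall>k. \<theta> k \<in> J \<longrightarrow>
        (x \<longlongrightarrow> x (\<theta> k)) (at (\<theta> k) within (J \<inter> {..<\<theta> k})) \<and>
        (\<exists>r. (x \<longlongrightarrow> r) (at_right (\<theta> k)) \<and> r - x (\<theta> k) = G k (x (\<theta> k))))"

text \<open>Asymptotic stability in the sense of Lyapunov: stability and local attractivity.\<close>

definition asymptotically_stable ::
  "(int \<Rightarrow> real) \<Rightarrow> (real \<Rightarrow> real^'m \<Rightarrow> real^'m) \<Rightarrow> (int \<Rightarrow> real^'m \<Rightarrow> real^'m)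
   \<Rightarrow> (real \<Rightarrow> real^'m) \<Rightarrow> bool" where
  "asymptotically_stable \<theta> F G x \<longleftrightarrow>
     (\<forall>t\<^sub>0. \<forall>\<epsilon>>0. \<exists>\<delta>>0. \<forall>y. impulsive_solution_on {t\<^sub>0..} \<theta> F G y \<and> norm (y t\<^sub>0 - x t\<^sub>0) < \<delta> \<longrightarrow>
        (\<forall>t\<ge>t\<^sub>0. norm (y t - x t) < \<epsilon>)) \<and>
     (\<forall>t\<^sub>0. \<exists>\<delta>>0. \<forall>y. impulsive_solution_on {t\<^sub>0..} \<theta> F G y \<and> norm (y t\<^sub>0 - x t\<^sub>0) < \<delta> \<longrightarrow>
        ((\<lambda>t. norm (y t - x t)) \<longlongrightarrow> 0) at_top)"

end

theory Submission
  imports Defs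
begin

text \<open>For a vector \<open>v\<close> at time \<open>s\<close> take the Lyapunov norm \<open>sup {exp (lam (t - s)) \<bar>U(t,s) v\<bar> | t \<ge> s}\<close>.
  In this norm the difference of two solutions grows along a segment between two impulses at most
  with rate \<open>N Lf - lam\<close>, and an impulse multiplies it at most by \<open>1 + N Lh\<close>. Since there are
  \<open>p\<close> impulses per period, hypothesis (7) makes solutions approach each other exponentially, up to an
  error proportional to the difference of their inputs. Everything follows from this comparison:
  solutions started ever earlier converge to a bounded solution on the line, which is unique, depends
  continuously on the inputs locally uniformly, and attracts all other solutions. For the input \<open>\<alpha>\<close> in
  place of \<open>g\<^sub>1 + g\<^sub>2\<close> and no \<open>\<gamma>\<close> the bounded solution inherits the unpredictability of \<open>\<alpha>\<close>; its
  difference to the one for the given input tends to zero.\<close>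

section \<open>Matrix powers and the matrix exponential\<close>

text \<open>Estimating in the Euclidean norm from one impulse to the next would cost a factor
  \<open>N\<close> each time, \<open>N ^ p\<close> per period, and (7) has no room for that. In the
  Lyapunov norm only the perturbation pays \<open>N\<close>. This norm is a supremum and need not be
  differentiable, so it is never formed: \<open>dominated\<close> bounds every propagated value
  U(t,s) d(s) separately, and these are differentiable in s, with derivative U(t,s) r(s) when d' = A
  d + r. The bound is an explicit majorant whose weight \<open>P\<close> jumps by \<beta> at each
  impulse and decays in between so that it stays between two positive constants. The slack
  \<open>gap\<close> of (7) is spent in two halves: one makes \<beta> exceed
  \<open>1 + N * Lh\<close>, so that an impulse can absorb an input error; the other provides the
  decay rate \<eta> and absorbs the input error between impulses. Solutions are continuous from the
  left and may start at an impulse moment, hence comparisons take right limits as initial values.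
  Recurrence rests on the common period of \<open>f\<close> and \<theta>: a shift by a multiple of
  \<omega> is again a solution, for the shifted input.\<close>

lemma matrix_power_commute: "M ** matrix_power M n = matrix_power M n ** M"
  by (induction n) (simp_all add: matrix_mul_assoc)

lemma matrix_power_commute_right:
  assumes "A ** B = B ** A"
  shows "A ** matrix_power B n = matrix_power B n ** A"
  by (induction n) (simp_all, metis assms matrix_mul_assoc)

lemma matrix_add_rdistrib: "(B + C) ** A = B ** A + C ** A"
  by (vector matrix_matrix_mult_def sum.distrib[symmetric] field_simps)

lemma commute_add_mat_1:
  fixes A B :: "real^'n^'n"
  assumes "A ** B = B ** A"
  shows "A ** (mat 1 + B) = (mat 1 + B) ** A"
  using assms by (simp add: matrix_add_ldistrib matrix_add_rdistrib)

lemma matrix_power_scaleR: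
  fixes M :: "real^'n^'n"
  shows "matrix_power (c *\<^sub>R M) n = c ^ n *\<^sub>R matrix_power M n"
  by (induction n) (simp_all add: scalar_matrix_assoc[symmetric] matrix_scalar_ac mult.commute)

lemma norm_matrix_vector_mult_le: "norm (M *v x) \<le> spectral_norm M * norm x"
  for M :: "real^'n^'n"
  unfolding spectral_norm_def by (rule onorm) simp

text \<open>Column \<open>j\<close> of the power is the image of \<open>axis j 1\<close>, and an
  entry is at most the norm of its column. Entrywise bounds turn the matrix exponential into
  ordinary real power series.\<close>

lemma matrix_power_nth_le:
  fixes M :: "real^'n^'n"
  shows "\<bar>matrix_power M n $ i $ j\<bar> \<le> spectral_norm M ^ n"
proof -
  have pos: "0 \<le> spectral_norm M"
    unfolding spectral_norm_def by (rule onorm_pos_le) simp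
  have *: "norm (matrix_power M n *v x) \<le> spectral_norm M ^ n * norm x" for x :: "real^'n"
  proof (induction n)
    case (Suc n)
    have "norm (matrix_power M (Suc n) *v x) \<le> spectral_norm M * norm (matrix_power M n *v x)"
      by (simp add: norm_matrix_vector_mult_le flip: matrix_vector_mul_assoc)
    also have "\<dots> \<le> spectral_norm M * (spectral_norm M ^ n * norm x)"
      by (intro mult_left_mono Suc pos)
    finally show ?case by (simp add: mult.assoc)
  qed simp
  have "\<bar>(matrix_power M n *v axis j 1) $ i\<bar> \<le> norm (matrix_power M n *v axis j (1::real))"
    by (rule component_le_norm_cart)
  also have "\<dots> \<le> spectral_norm M ^ n"
    using *[of "axis j 1"] by simp
  finally show ?thesis
    by (simp add: matrix_vector_mul_component inner_axis)
qed

lemma matrix_exp_series_summable: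
  fixes M :: "real^'n^'n"
  shows "summable (\<lambda>n. (inverse (fact n) * matrix_power M n $ i $ j) * t ^ n)"
proof (rule summable_comparison_test'[OF summable_exp[of "spectral_norm M * \<bar>t\<bar>"]])
  fix n :: nat
  have "\<bar>matrix_power M n $ i $ j\<bar> * \<bar>t\<bar> ^ n \<le> spectral_norm M ^ n * \<bar>t\<bar> ^ n"
    by (intro mult_right_mono matrix_power_nth_le) simp
  then show "norm ((inverse (fact n) * matrix_power M n $ i $ j) * t ^ n)
      \<le> inverse (fact n) * (spectral_norm M * \<bar>t\<bar>) ^ n"
    by (simp add: abs_mult power_abs power_mult_distrib field_simps)
qed

lemma matrix_exp_nth:
  fixes M :: "real^'n^'n"
  shows "matrix_exp (t *\<^sub>R M) $ i $ j
    = (\<Sum>n. (inverse (fact n) * matrix_power M n $ i $ j) * t ^ n)"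
proof -
  have "(\<lambda>n. inverse (fact n) *\<^sub>R matrix_power (t *\<^sub>R M) n) sums
      (\<chi> i j. \<Sum>n. (inverse (fact n) * matrix_power M n $ i $ j) * t ^ n)"
    unfolding sums_def
  proof (intro vec_tendstoI)
    fix i j
    have "(\<lambda>n. (inverse (fact n) * matrix_power M n $ i $ j) * t ^ n)
        sums (\<Sum>n. (inverse (fact n) * matrix_power M n $ i $ j) * t ^ n)"
      by (rule summable_sums[OF matrix_exp_series_summable])
    then show "(\<lambda>n. (\<Sum>k<n. inverse (fact k) *\<^sub>R matrix_power (t *\<^sub>R M) k) $ i $ j)
      \<longlonglongrightarrow> (\<chi> i j. \<Sum>n. (inverse (fact n) * matrix_power M n $ i $ j) * t ^ n) $ i $ j"
      by (simp add: sums_def matrix_power_scaleR mult_ac)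
  qed
  then show ?thesis
    unfolding matrix_exp_def by (simp add: sums_unique[symmetric])
qed

lemma matrix_exp_0 [simp]: "matrix_exp (0 :: real^'n^'n) = mat 1"
proof -
  have "matrix_exp (0 *\<^sub>R (0 :: real^'n^'n)) $ i $ j = mat 1 $ i $ j" for i j
    unfolding matrix_exp_nth using powser_sums_zero[of "\<lambda>n. inverse (fact n) * matrix_power 0 n $ i $ j"]
    by (simp add: sums_iff)
  then show ?thesis by (simp add: vec_eq_iff)
qed

lemma matrix_exp_has_vector_derivative:
  fixes M :: "real^'n^'n"
  shows "((\<lambda>t. matrix_exp (t *\<^sub>R M)) has_vector_derivative matrix_exp (t *\<^sub>R M) ** M) (at t)"
proof -
  have "((\<lambda>t. matrix_exp (t *\<^sub>R M) $ i $ j) has_real_derivative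
      (matrix_exp (t *\<^sub>R M) ** M) $ i $ j) (at t)" for i j
  proof -
    define c where "c i j n = inverse (fact n) * matrix_power M n $ i $ j" for i j n
    have "((\<lambda>t. \<Sum>n. c i j n * t ^ n) has_real_derivative (\<Sum>n. diffs (c i j) n * t ^ n)) (at t)"
      by (rule termdiffs_strong_converges_everywhere)
        (auto simp: c_def intro: matrix_exp_series_summable)
    moreover have "diffs (c i j) n * t ^ n = (\<Sum>k\<in>UNIV. (c i k n * t ^ n) * M $ k $ j)" for n
    proof -
      \<comment> \<open>\<open>diffs\<close> moves to the coefficient \<open>n + 1\<close> and
        multiplies it by \<open>n + 1\<close>; this cancels one factor of the factorial and leaves
        one more factor \<open>M\<close>, which is moved to the right.\<close>
      have "diffs (c i j) n = inverse (fact n) * (matrix_power M n ** M) $ i $ j"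
        by (simp add: diffs_def c_def matrix_power_commute field_simps del: of_nat_Suc)
      then show ?thesis
        by (simp add: matrix_matrix_mult_def c_def sum_distrib_left sum_distrib_right mult_ac)
    qed
    moreover have "(\<Sum>n. \<Sum>k\<in>UNIV. (c i k n * t ^ n) * M $ k $ j)
        = (\<Sum>k\<in>UNIV. (\<Sum>n. c i k n * t ^ n) * M $ k $ j)"
      by (subst suminf_sum)
        (auto simp: c_def suminf_mult2[OF matrix_exp_series_summable]
          intro!: summable_mult2 matrix_exp_series_summable)
    ultimately show ?thesis
      by (simp add: matrix_exp_nth c_def matrix_matrix_mult_def)
  qed
  then have "((\<lambda>t. matrix_exp (t *\<^sub>R M) $ i $ j) has_derivative
      (\<lambda>s. s * (matrix_exp (t *\<^sub>R M) ** M) $ i $ j)) (at t)" for i j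
    by (simp add: has_field_derivative_def mult_commute_abs)
  then show ?thesis
    unfolding has_vector_derivative_def
    by (subst has_derivative_componentwise_within) (auto simp: Basis_vec_def inner_axis)
qed

lemma matrix_vector_mult_minus: "(- M) *v x = - (M *v x)" for M :: "real^'n^'m"
  by (vector matrix_vector_mult_def sum_negf)

lemma bounded_bilinear_matrix_vector_mult:
  "bounded_bilinear ((*v) :: real^'n^'m \<Rightarrow> real^'n \<Rightarrow> real^'m)"
  unfolding bilinear_conv_bounded_bilinear[symmetric] bilinear_def
  by (auto intro!: linearI simp: matrix_vector_mult_add_rdistrib matrix_vector_right_distrib
      matrix_vector_mult_scaleR scaleR_matrix_vector_assoc[symmetric])

section \<open>Impulse moments\<close>

locale impulse_sequence =
  fixes p :: nat and \<omega> :: real and \<theta> :: "int \<Rightarrow> real"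
  assumes p_pos: "p \<ge> 1" and \<omega>_pos: "\<omega> > 0" and \<theta>: "\<theta> \<in> impulse_moments p \<omega>"
begin

lemma less_iff: "\<theta> i < \<theta> j \<longleftrightarrow> i < j" and le_iff: "\<theta> i \<le> \<theta> j \<longleftrightarrow> i \<le> j"
  using \<theta> by (auto simp: impulse_moments_def strict_mono_less strict_mono_less_eq)

lemma shift: "\<theta> (k + j * int p) = \<theta> k + of_int j * \<omega>"
proof (induction j rule: int_induct[where k = 0])
  case base
  then show ?case by simp
next
  case (step1 i)
  have "\<theta> (k + i * int p + int p) = \<theta> (k + i * int p) + \<omega>"
    using \<theta> by (simp add: impulse_moments_def)
  with step1 show ?case by (simp add: algebra_simps)
next
  case (step2 i)
  have "\<theta> (k + (i - 1) * int p + int p) = \<theta> (k + (i - 1) * int p) + \<omega>"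
    using \<theta> by (simp add: impulse_moments_def)
  with step2 show ?case by (simp add: algebra_simps)
qed

lemma step_le: "\<theta> k - \<theta> (k - 1) \<le> \<omega>"
proof -
  have "\<theta> k \<le> \<theta> ((k - 1) + 1 * int p)"
    using p_pos by (simp add: le_iff)
  then show ?thesis by (simp only: shift)
qed

lemma ex_below: "\<exists>k. \<theta> k < t"
proof -
  have "\<theta> (0 + (\<lfloor>(t - \<theta> 0) / \<omega>\<rfloor> - 1) * int p) < t"
    unfolding shift using \<omega>_pos
    by (smt (verit) floor_correct of_int_diff of_int_1 pos_less_divide_eq pos_le_divide_eq mult.commute)
  then show ?thesis by blast
qed

lemma ex_above: "\<exists>k. t \<le> \<theta> k"
proof -
  have "t \<le> \<theta> (0 + \<lceil>(t - \<theta> 0) / \<omega>\<rceil> * int p)"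
    unfolding shift using \<omega>_pos le_of_int_ceiling[of "(t - \<theta> 0) / \<omega>"]
    by (simp add: pos_divide_le_eq del: le_of_int_ceiling)
  then show ?thesis by blast
qed

lemma ex_segment: "\<exists>k. \<theta> (k - 1) < t \<and> t \<le> \<theta> k"
proof -
  obtain i j where ij: "\<theta> i < t" "t \<le> \<theta> j" using ex_below ex_above by blast
  then have "i < j" using less_iff by (meson order_less_le_trans)
  define P where "P n \<longleftrightarrow> t \<le> \<theta> (i + int n)" for n
  have "P (nat (j - i))" using ij \<open>i < j\<close> by (simp add: P_def)
  define n where "n = (LEAST n. P n)"
  have "P n" unfolding n_def by (rule LeastI[of P, OF \<open>P (nat (j - i))\<close>])
  moreover have "n \<noteq> 0" using \<open>P n\<close> ij by (auto simp: P_def intro: gr0I)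
  moreover have "\<not> P (n - 1)"
    using not_less_Least[of "n - 1" P] \<open>n \<noteq> 0\<close> by (simp add: n_def[symmetric])
  ultimately show ?thesis
    by (intro exI[of _ "i + int n"]) (auto simp: P_def of_nat_diff algebra_simps not_le)
qed

lemma segment_unique:
  assumes "\<theta> (k - 1) < t" "t \<le> \<theta> k" "\<theta> (j - 1) < t" "t \<le> \<theta> j"
  shows "k = j"
proof -
  have "\<theta> (k - 1) < \<theta> j" "\<theta> (j - 1) < \<theta> k" using assms by auto
  then show ?thesis by (simp add: less_iff)
qed

text \<open>Segments are open on the left and closed on the right, as suits left continuous
  functions; so they partition the line and the index is unique.\<close>

definition idx :: "real \<Rightarrow> int" where
  "idx t = (THE k. \<theta> (k - 1) < t \<and> t \<le> \<theta> k)"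

lemma idx: "\<theta> (idx t - 1) < t" "t \<le> \<theta> (idx t)"
proof -
  have "\<exists>!k. \<theta> (k - 1) < t \<and> t \<le> \<theta> k" using ex_segment segment_unique by blast
  from theI'[OF this] show "\<theta> (idx t - 1) < t" "t \<le> \<theta> (idx t)" by (auto simp: idx_def)
qed

lemma idx_eqI: "\<theta> (k - 1) < t \<Longrightarrow> t \<le> \<theta> k \<Longrightarrow> idx t = k"
  using idx segment_unique by blast

text \<open>The opposite convention, for a motion that starts at \<open>t\<close> and runs to the
  right: a moment belongs here to the segment that it opens.\<close>

lemma ex_segment_right: "\<exists>k. \<theta> (k - 1) \<le> t \<and> t < \<theta> k"
proof (cases "t = \<theta> (idx t)")
  case True
  then show ?thesis by (intro exI[of _ "idx t + 1"]) (simp, metis less_iff zless_add1_eq)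
next
  case False
  then show ?thesis using idx[of t] by (intro exI[of _ "idx t"]) auto
qed

lemma not_moment: "\<theta> (k - 1) < t \<Longrightarrow> t < \<theta> k \<Longrightarrow> t \<notin> range \<theta>"
  by (auto simp: less_iff)

text \<open>The first moment counted is \<open>\<theta> j\<close>, even if it equals
  \<open>s\<close>, and the last is \<open>\<theta> (k - 1)\<close>, since \<open>\<theta> k\<close>
  is not below \<open>t\<close>. Impulse counts thus become differences of segment indices.\<close>

lemma moments_in_eq:
  assumes "\<theta> (j - 1) < s" "s \<le> \<theta> j" "\<theta> (k - 1) < t" "t \<le> \<theta> k" "s \<le> t"
  shows "moments_in \<theta> {s..<t} = nat (k - j)"
proof -
  have "{i. \<theta> i \<in> {s..<t}} = {j..k - 1}"
  proof (intro set_eqI iffI)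
    fix i assume "i \<in> {i. \<theta> i \<in> {s..<t}}"
    then have "\<theta> (j - 1) < \<theta> i" "\<theta> i < \<theta> k" using assms by auto
    then show "i \<in> {j..k - 1}" by (simp add: less_iff)
  next
    fix i assume "i \<in> {j..k - 1}"
    then have "\<theta> j \<le> \<theta> i" "\<theta> i \<le> \<theta> (k - 1)" by (auto simp: le_iff)
    then show "i \<in> {i. \<theta> i \<in> {s..<t}}" using assms by auto
  qed
  then show ?thesis by (simp add: moments_in_def)
qed

text \<open>Reduction modulo \<open>p\<close> leaves finitely many values. This will bound the
  deviation of the index of a moment from a linear function of time.\<close>

lemma periodic_bounded:
  fixes D :: "int \<Rightarrow> real"
  assumes "\<And>k j. D (k + j * int p) = D k"
  shows "\<exists>C. \<forall>k. \<bar>D k\<bar> \<le> C"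
proof -
  have D: "D k = D (k mod int p)" for k
    using assms[of "k mod int p" "k div int p"] by simp
  have "\<bar>D k\<bar> \<le> (\<Sum>i\<in>{0..<int p}. \<bar>D i\<bar>)" for k
    using p_pos by (subst D) (rule member_le_sum, auto)
  then show ?thesis by blast
qed

end

section \<open>A Lyapunov norm for the linear system\<close>

locale dissipative = impulse_sequence +
  fixes A B :: "real^'m^'m" and N lam :: real
  assumes commute: "A ** B = B ** A" and N_ge_1: "N \<ge> 1" and lam_pos: "lam > 0"
    and matriciant_le:
      "\<And>t s. s \<le> t \<Longrightarrow> spectral_norm (matriciant A B \<theta> t s) \<le> N * exp (- lam * (t - s))"
begin

text \<open>The matriciant applied to a vector, with the number of impulses as an argument of its
  own. For fixed \<open>n\<close> it is smooth in the time, and it also fits a state at a moment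
  whose impulse has already been carried out.\<close>

definition propagator :: "nat \<Rightarrow> real \<Rightarrow> real^'m \<Rightarrow> real^'m" where
  "propagator n s v = matrix_exp (s *\<^sub>R A) *v (matrix_power (mat 1 + B) n *v v)"

lemma propagator_0 [simp]: "propagator 0 0 v = v"
  by (simp add: propagator_def)

lemma propagator_add: "propagator n s (v + w) = propagator n s v + propagator n s w"
  by (simp add: propagator_def matrix_vector_right_distrib)

lemma propagator_Suc: "propagator (Suc n) s v = propagator n s (v + B *v v)"
proof -
  have "matrix_power (mat 1 + B) (Suc n) *v v = matrix_power (mat 1 + B) n *v ((mat 1 + B) *v v)"
    by (simp add: matrix_power_commute matrix_vector_mul_assoc)
  then show ?thesis
    by (simp add: propagator_def matrix_vector_mult_add_rdistrib)
qed

lemma continuous_on_propagator: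
  assumes "continuous_on S d"
  shows "continuous_on S (\<lambda>s. propagator n (t - s) (d s))"
proof -
  have "continuous_on UNIV (\<lambda>s. matrix_exp (s *\<^sub>R A))"
    by (intro continuous_at_imp_continuous_on ballI has_vector_derivative_continuous)
      (rule matrix_exp_has_vector_derivative)
  then have "continuous_on S (\<lambda>s. matrix_exp ((t - s) *\<^sub>R A))"
    by (rule continuous_on_compose2) (auto intro!: continuous_intros)
  moreover have "continuous_on S (\<lambda>s. matrix_power (mat 1 + B) n *v d s)"
    by (rule bounded_linear.continuous_on[OF matrix_vector_mul_bounded_linear assms])
  ultimately show ?thesis
    unfolding propagator_def
    by (rule bounded_bilinear.continuous_on[OF bounded_bilinear_matrix_vector_mult])
qed

text \<open>Variation of constants in differential form: the terms with \<open>A\<close> cancel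
  because \<open>A\<close> commutes with the powers of \<open>mat 1 + B\<close>, and only the
  perturbation is left.\<close>

lemma propagator_has_vector_derivative:
  assumes "(d has_vector_derivative A *v d s + r) (at s)"
  shows "((\<lambda>s. propagator n (t - s) (d s)) has_vector_derivative propagator n (t - s) r) (at s)"
proof -
  let ?P = "matrix_power (mat 1 + B) n" and ?E = "matrix_exp ((t - s) *\<^sub>R A)"
  have "((\<lambda>s. t - s) has_vector_derivative -1) (at s)"
    by (auto intro!: derivative_eq_intros)
  from vector_diff_chain_at[OF this matrix_exp_has_vector_derivative[of A "t - s"]]
  have E: "((\<lambda>s. matrix_exp ((t - s) *\<^sub>R A)) has_vector_derivative - (?E ** A)) (at s)"
    by (simp add: o_def)
  have d: "((\<lambda>s. ?P *v d s) has_vector_derivative ?P *v (A *v d s + r)) (at s)"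
    using bounded_linear.has_vector_derivative[OF matrix_vector_mul_bounded_linear assms] .
  have AP: "A *v (?P *v x) = ?P *v (A *v x)" for x
    using matrix_power_commute_right[OF commute_add_mat_1[OF commute]]
    by (simp add: matrix_vector_mul_assoc)
  show ?thesis
    using bounded_bilinear.has_vector_derivative[OF bounded_bilinear_matrix_vector_mult E d]
    by (simp add: propagator_def matrix_vector_right_distrib AP matrix_vector_mult_minus
        matrix_vector_mul_assoc[symmetric])
qed

text \<open>A state at \<open>s = \<theta> (j - 1)\<close> with index \<open>j\<close> has already
  undergone the impulse at \<open>s\<close>, whereas the matriciant from \<open>s\<close> would
  still carry it out. There the bound is the limit of the bounds for starting times slightly to the
  right of \<open>s\<close>.\<close>

lemma propagator_le:
  assumes "\<theta> (j - 1) \<le> s" "s \<le> \<theta> j" "\<theta> (k - 1) < t" "t \<le> \<theta> k" "s \<le> t" "j \<le> k"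
  shows "norm (propagator (nat (k - j)) (t - s) v) \<le> N * exp (- lam * (t - s)) * norm v"
proof -
  have *: "norm (propagator (nat (k - j)) (t - s) v) \<le> N * exp (- lam * (t - s)) * norm v"
    if s: "\<theta> (j - 1) < s" "s \<le> \<theta> j" "s \<le> t" for s
  proof (cases "s = t")
    case True
    then have "j = k" using segment_unique s assms by blast
    then show ?thesis using True N_ge_1 mult_right_mono[of 1 N "norm v"] by simp
  next
    case False
    have "norm (matriciant A B \<theta> t s *v v) \<le> N * exp (- lam * (t - s)) * norm v"
      by (rule order_trans[OF norm_matrix_vector_mult_le mult_right_mono[OF matriciant_le]])
        (use s in auto)
    moreover have "matriciant A B \<theta> t s *v v = propagator (nat (k - j)) (t - s) v"
      using False s assms
      by (simp add: matriciant_def propagator_def moments_in_eq[of j s k t] matrix_vector_mul_assoc)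
    ultimately show ?thesis by simp
  qed
  show ?thesis
  proof (cases "\<theta> (j - 1) = s")
    case False
    then show ?thesis using * assms by simp
  next
    case True
    have "s < t" "s < \<theta> j"
      using True assms le_iff[of "j - 1" "k - 1"] less_iff[of "j - 1" j] by auto
    then have ev: "\<forall>\<^sub>F u in at_right s. s < u \<and> u < min t (\<theta> j)"
      unfolding eventually_at_right_field by (intro exI[of _ "min t (\<theta> j)"]) auto
    have "((\<lambda>u. norm (propagator (nat (k - j)) (t - u) v)) \<longlongrightarrow>
        norm (propagator (nat (k - j)) (t - s) v)) (at_right s)"
      using continuous_on_propagator[OF continuous_on_const[of UNIV v]]
      by (intro tendsto_norm) (auto simp: continuous_on_def intro: tendsto_within_subset)
    moreover have "((\<lambda>u. N * exp (- lam * (t - u)) * norm v) \<longlongrightarrow>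
        N * exp (- lam * (t - s)) * norm v) (at_right s)"
      by (intro tendsto_intros)
    moreover have "\<forall>\<^sub>F u in at_right s. norm (propagator (nat (k - j)) (t - u) v)
        \<le> N * exp (- lam * (t - u)) * norm v"
      using ev by eventually_elim (rule *, use True in auto)
    ultimately show ?thesis by (intro tendsto_le[OF trivial_limit_at_right_real])
  qed
qed

text \<open>\<open>dominated k s v c\<close> says that the Lyapunov norm of \<open>v\<close> at time \<open>s\<close> in the segment with index
  \<open>k\<close>, i.e. the supremum of \<open>exp (lam t) \<bar>U(t,s) v\<bar>\<close> over \<open>t \<ge> s\<close>, is at most \<open>c\<close>. In contrast to
  the Euclidean norm it does not pick up a factor \<open>N\<close> when one passes from a segment to the next.\<close>

definition dominated :: "int \<Rightarrow> real \<Rightarrow> real^'m \<Rightarrow> real \<Rightarrow> bool" where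
  "dominated k s v c \<longleftrightarrow> (\<forall>j t. k \<le> j \<longrightarrow> \<theta> (j - 1) < t \<longrightarrow> t \<le> \<theta> j \<longrightarrow> s \<le> t \<longrightarrow>
     exp (lam * t) * norm (propagator (nat (j - k)) (t - s) v) \<le> c)"

lemma exp_scale_le: "exp (lam * t) * x \<le> c * exp (lam * s) \<longleftrightarrow> x \<le> c * exp (- lam * (t - s))"
proof -
  have "exp (lam * s) = exp (lam * t) * exp (- lam * (t - s))"
    by (simp add: exp_add[symmetric] algebra_simps)
  then have "c * exp (lam * s) = exp (lam * t) * (c * exp (- lam * (t - s)))" by simp
  then show ?thesis by (simp only: mult_le_cancel_left_pos[OF exp_gt_zero])
qed

lemma exp_mult_le_iff: "exp (lam * t) * x \<le> c \<longleftrightarrow> x \<le> exp (- lam * t) * c"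
  by (simp add: exp_minus pos_le_divide_eq mult.commute flip: divide_inverse)

text \<open>Passing from the Euclidean to the Lyapunov norm costs \<open>N\<close>. In
  \<open>comparison\<close> this is paid for the initial value and for the perturbation of each
  jump, never for the whole state at an impulse.\<close>

lemma dominatedI_norm:
  assumes "\<theta> (k - 1) \<le> s" "s \<le> \<theta> k"
  shows "dominated k s v (N * exp (lam * s) * norm v)"
  unfolding dominated_def
proof (intro allI impI)
  fix j t assume "k \<le> j" "\<theta> (j - 1) < t" "t \<le> \<theta> j" "s \<le> t"
  with assms have "norm (propagator (nat (j - k)) (t - s) v) \<le> (N * norm v) * exp (- lam * (t - s))"
    using propagator_le[of k s j t v] by (simp add: mult_ac)
  then show "exp (lam * t) * norm (propagator (nat (j - k)) (t - s) v) \<le> N * exp (lam * s) * norm v"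
    unfolding exp_scale_le[symmetric] by (simp add: mult_ac)
qed

lemma dominated_mono: "dominated k s v c \<Longrightarrow> c \<le> c' \<Longrightarrow> dominated k s v c'"
  unfolding dominated_def by (meson order_trans)

lemma dominated_add:
  assumes "dominated k s v c" "dominated k s w c'"
  shows "dominated k s (v + w) (c + c')"
  unfolding dominated_def
proof (intro allI impI)
  fix j t assume *: "k \<le> j" "\<theta> (j - 1) < t" "t \<le> \<theta> j" "s \<le> t"
  have "exp (lam * t) * norm (propagator (nat (j - k)) (t - s) (v + w))
     \<le> exp (lam * t) * norm (propagator (nat (j - k)) (t - s) v)
      + exp (lam * t) * norm (propagator (nat (j - k)) (t - s) w)"
    by (simp add: propagator_add distrib_left[symmetric] norm_triangle_ineq)
  also have "\<dots> \<le> c + c'"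
    using assms * by (intro add_mono) (auto simp: dominated_def)
  finally show "exp (lam * t) * norm (propagator (nat (j - k)) (t - s) (v + w)) \<le> c + c'" .
qed

text \<open>The linear part of the jump is already one of the factors of the propagator into later
  segments, so fewer times compete in the supremum and \<open>c\<close> need not grow.\<close>

lemma dominated_jump:
  assumes "dominated k (\<theta> k) v c"
  shows "dominated (k + 1) (\<theta> k) (v + B *v v) c"
  unfolding dominated_def
proof (intro allI impI)
  fix j t assume *: "k + 1 \<le> j" "\<theta> (j - 1) < t" "t \<le> \<theta> j" "\<theta> k \<le> t"
  have "nat (j - k) = Suc (nat (j - (k + 1)))" using * by simp
  moreover have "exp (lam * t) * norm (propagator (nat (j - k)) (t - \<theta> k) v) \<le> c"
    using assms * unfolding dominated_def by auto
  ultimately show "exp (lam * t) * norm (propagator (nat (j - (k + 1))) (t - \<theta> k) (v + B *v v)) \<le> c"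
    by (simp only: propagator_Suc)
qed

text \<open>Take \<open>t = s\<close> in the same segment. At the left end
  \<open>s = \<theta> (k - 1)\<close> that time belongs to the previous segment, so \<open>t\<close>
  tends to \<open>s\<close> from the right instead.\<close>

lemma dominated_imp_norm_le:
  assumes "dominated k s v c" "\<theta> (k - 1) \<le> s" "s \<le> \<theta> k"
  shows "exp (lam * s) * norm v \<le> c"
proof (cases "\<theta> (k - 1) = s")
  case False
  then show ?thesis using assms unfolding dominated_def by (force dest: spec[of _ k])
next
  case True
  then have "s < \<theta> k" using less_iff[of "k - 1" k] by simp
  then have ev: "\<forall>\<^sub>F t in at_right s. s < t \<and> t < \<theta> k"
    by (auto simp: eventually_at_right_field)
  have "continuous_on UNIV (\<lambda>u. propagator 0 (0 - u) v)"
    by (intro continuous_on_propagator continuous_on_const)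
  then have "continuous_on UNIV (\<lambda>t. propagator 0 (0 - (s - t)) v)"
    by (rule continuous_on_compose2) (auto intro!: continuous_intros)
  then have "((\<lambda>t. propagator 0 (0 - (s - t)) v) \<longlongrightarrow> propagator 0 (0 - (s - s)) v) (at_right s)"
    unfolding continuous_on_def by (meson UNIV_I subset_UNIV tendsto_within_subset)
  then have "((\<lambda>t. exp (lam * t) * norm (propagator 0 (t - s) v)) \<longlongrightarrow> exp (lam * s) * norm v)
      (at_right s)"
    by (intro tendsto_intros tendsto_norm) auto
  then show ?thesis
    by (rule tendsto_upperbound)
      (use ev assms True in \<open>auto simp: dominated_def elim!: eventually_mono dest: spec[of _ k]\<close>)
qed

end

text \<open>The times that violate the inequality form a compact set; at the first of them
  \<open>step\<close> gives a contradiction. The case \<open>t = a\<close> is included, with nothing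
  assumed about earlier times.\<close>

lemma first_crossing:
  fixes e v :: "real \<Rightarrow> real"
  assumes "continuous_on {a..b} e" "continuous_on {a..b} v"
    and step: "\<And>t. a \<le> t \<Longrightarrow> t \<le> b \<Longrightarrow> (\<And>s. a \<le> s \<Longrightarrow> s < t \<Longrightarrow> e s < v s) \<Longrightarrow> e t < v t"
    and "a \<le> t" "t \<le> b"
  shows "e t < v t"
proof (rule ccontr)
  assume "\<not> e t < v t"
  define S where "S = {s \<in> {a..b}. v s \<le> e s}"
  have "closed S"
    unfolding S_def using assms by (intro continuous_on_closed_Collect_le) auto
  moreover have "bounded S" by (rule bounded_subset[of "{a..b}"]) (auto simp: S_def)
  ultimately have "compact S" by (simp add: compact_eq_bounded_closed)
  moreover have "t \<in> S" using assms \<open>\<not> e t < v t\<close> by (simp add: S_def)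
  ultimately obtain m where m: "m \<in> S" "\<And>s. s \<in> S \<Longrightarrow> m \<le> s"
    using compact_attains_inf[of S] by blast
  have "e s < v s" if "a \<le> s" "s < m" for s
  proof (rule ccontr)
    assume "\<not> e s < v s"
    then have "s \<in> S" using m(1) that by (simp add: S_def)
    then show False using m(2) that by force
  qed
  then have "e m < v m" by (rule step[rotated 2]) (use m(1) in \<open>simp_all add: S_def\<close>)
  then show False using m(1) by (simp add: S_def)
qed

section \<open>Growth of the Lyapunov norm between two impulses\<close>

context dissipative
begin

text \<open>Estimating the perturbation needs the scalar bound
  \<open>exp (lam * s) * norm (d s) \<le> V s\<close>, while the resulting domination implies that
  same bound; \<open>first_crossing\<close> breaks the circle. \<open>V_super\<close> says that
  \<open>V\<close> grows at least as fast as the perturbation can push, once this is weighted by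
  \<open>N * exp (lam * s)\<close>.\<close>

lemma dominated_segment:
  assumes a: "\<theta> (k - 1) \<le> a" "a < T" "T \<le> \<theta> k"
    and cont: "continuous_on {a..T} d"
    and deriv: "\<And>s. a < s \<Longrightarrow> s < T \<Longrightarrow> (d has_vector_derivative A *v d s + r s) (at s)"
    and r: "\<And>s. a < s \<Longrightarrow> s < T \<Longrightarrow> norm (r s) \<le> L * norm (d s) + \<epsilon>"
    and pos: "L \<ge> 0" "\<epsilon> \<ge> 0"
    and V: "\<And>s. (V has_real_derivative V' s) (at s)"
    and V_pos: "\<And>s. V s > 0"
    and V_super: "\<And>s. a < s \<Longrightarrow> s < T \<Longrightarrow> N * (L * V s + \<epsilon> * exp (lam * s)) \<le> V' s"
    and start: "dominated k a (d a) (V a)"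
  shows "dominated k T (d T) (V T)"
proof -
  have contV: "continuous_on S V" for S
    using V by (meson DERIV_isCont continuous_at_imp_continuous_on)
  \<comment> \<open>Mean value inequality for the propagated difference as a function of
    \<open>s\<close>. Only the increment of \<open>V\<close> is inflated by
    \<open>1 + \<zeta>\<close>; the start keeps its sharp bound \<open>V a\<close>.\<close>
  have mean: "dominated k t (d t) (V a + (1 + \<zeta>) * (V t - V a))"
    if t: "a \<le> t" "t \<le> T" and \<zeta>: "\<zeta> \<ge> 0"
      and le: "\<And>s. a < s \<Longrightarrow> s < t \<Longrightarrow> exp (lam * s) * norm (d s) \<le> (1 + \<zeta>) * V s" for t \<zeta>
  proof (cases "t = a")
    case True
    then show ?thesis using start by simp
  next
    case False
    show ?thesis unfolding dominated_def
    proof (intro allI impI)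
      fix j u assume u: "k \<le> j" "\<theta> (j - 1) < u" "u \<le> \<theta> j" "t \<le> u"
      define f where "f s = propagator (nat (j - k)) (u - s) (d s)" for s
      define \<phi> where "\<phi> s = exp (- lam * u) * ((1 + \<zeta>) * V s)" for s
      have "norm (f t - f a) \<le> \<phi> t - \<phi> a"
      proof (rule differentiable_bound_general)
        show "a < t" using False t by simp
        show "continuous_on {a..t} f" unfolding f_def
          by (rule continuous_on_propagator, rule continuous_on_subset[OF cont]) (use t in auto)
        show "continuous_on {a..t} \<phi>" unfolding \<phi>_def by (intro continuous_intros contV)
        fix s assume s: "a < s" "s < t"
        show "(f has_vector_derivative propagator (nat (j - k)) (u - s) (r s)) (at s)"
          unfolding f_def by (rule propagator_has_vector_derivative, rule deriv) (use s t in auto)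
        show "(\<phi> has_vector_derivative exp (- lam * u) * ((1 + \<zeta>) * V' s)) (at s)"
          unfolding \<phi>_def has_real_derivative_iff_has_vector_derivative[symmetric]
          by (intro DERIV_cmult V)
        have "exp (lam * s) * norm (r s) \<le> L * (exp (lam * s) * norm (d s)) + \<epsilon> * exp (lam * s)"
          using mult_left_mono[OF r, of s "exp (lam * s)"] s t by (simp add: algebra_simps)
        also have "\<dots> \<le> L * ((1 + \<zeta>) * V s) + (1 + \<zeta>) * (\<epsilon> * exp (lam * s))"
          using le[of s] s pos \<zeta> by (intro add_mono mult_left_mono) (auto simp: distrib_right)
        finally have "N * (exp (lam * s) * norm (r s))
            \<le> N * (L * ((1 + \<zeta>) * V s) + (1 + \<zeta>) * (\<epsilon> * exp (lam * s)))"
          using N_ge_1 by (intro mult_left_mono) auto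
        also have "\<dots> = (1 + \<zeta>) * (N * (L * V s + \<epsilon> * exp (lam * s)))"
          by (simp add: algebra_simps)
        also have "\<dots> \<le> (1 + \<zeta>) * V' s"
          using V_super[of s] s t \<zeta> by (intro mult_left_mono) auto
        finally have "N * norm (r s) * exp (lam * s) \<le> (1 + \<zeta>) * V' s" by (simp add: mult_ac)
        moreover have "exp (lam * u) * norm (propagator (nat (j - k)) (u - s) (r s))
            \<le> N * norm (r s) * exp (lam * s)"
          unfolding exp_scale_le
          using propagator_le[of k s j u "r s"] s t u a by (simp add: mult_ac)
        ultimately have "exp (lam * u) * norm (propagator (nat (j - k)) (u - s) (r s))
            \<le> (1 + \<zeta>) * V' s" by simp
        then show "norm (propagator (nat (j - k)) (u - s) (r s)) \<le> exp (- lam * u) * ((1 + \<zeta>) * V' s)"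
          by (simp only: exp_mult_le_iff)
      qed
      then have "exp (lam * u) * norm (f t - f a) \<le> (1 + \<zeta>) * (V t - V a)"
        unfolding exp_mult_le_iff \<phi>_def by (simp add: right_diff_distrib)
      moreover have "exp (lam * u) * norm (f a) \<le> V a"
        using start u t unfolding dominated_def f_def by auto
      moreover have "exp (lam * u) * norm (f t)
          \<le> exp (lam * u) * norm (f t - f a) + exp (lam * u) * norm (f a)"
        using norm_triangle_ineq[of "f t - f a" "f a"]
        by (simp add: distrib_left[symmetric])
      ultimately show "exp (lam * u) * norm (propagator (nat (j - k)) (u - t) (d t))
          \<le> V a + (1 + \<zeta>) * (V t - V a)" by (simp add: f_def)
    qed
  qed
  \<comment> \<open>The sharp bound at the start leaves a surplus \<open>\<zeta> * V a\<close>,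
    which yields the strict inequality that \<open>first_crossing\<close> asks for.\<close>
  have "exp (lam * s) * norm (d s) < (1 + \<zeta>) * V s" if "a \<le> s" "s \<le> T" "\<zeta> > 0" for s \<zeta>
  proof (rule first_crossing[where e = "\<lambda>s. exp (lam * s) * norm (d s)" and a = a and b = T])
    show "continuous_on {a..T} (\<lambda>s. exp (lam * s) * norm (d s))"
      by (intro continuous_intros cont)
    show "continuous_on {a..T} (\<lambda>s. (1 + \<zeta>) * V s)" by (intro continuous_intros contV)
    fix t assume t: "a \<le> t" "t \<le> T"
      and less: "\<And>s. a \<le> s \<Longrightarrow> s < t \<Longrightarrow> exp (lam * s) * norm (d s) < (1 + \<zeta>) * V s"
    have "dominated k t (d t) (V a + (1 + \<zeta>) * (V t - V a))"
      using t that less by (intro mean) (auto intro: less_imp_le)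
    then have "exp (lam * t) * norm (d t) \<le> V a + (1 + \<zeta>) * (V t - V a)"
      by (rule dominated_imp_norm_le) (use t a in auto)
    also have "\<dots> = (1 + \<zeta>) * V t - \<zeta> * V a" by (simp add: algebra_simps)
    also have "\<dots> < (1 + \<zeta>) * V t" using that V_pos by simp
    finally show "exp (lam * t) * norm (d t) < (1 + \<zeta>) * V t" .
  qed (use that in auto)
  then have le: "exp (lam * s) * norm (d s) \<le> (1 + \<zeta>) * V s" if "a \<le> s" "s \<le> T" "\<zeta> > 0" for s \<zeta>
    using that less_imp_le by blast
  have "exp (lam * s) * norm (d s) \<le> V s" if s: "a \<le> s" "s \<le> T" for s
  proof (rule field_le_epsilon)
    fix e :: real assume "e > 0"
    moreover have "(1 + e / V s) * V s = V s + e"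
      using V_pos[of s] by (simp add: distrib_right)
    ultimately show "exp (lam * s) * norm (d s) \<le> V s + e"
      using le[OF s, of "e / V s"] V_pos[of s] by simp
  qed
  \<comment> \<open>With the scalar bound now known without inflation, the mean value step is
    repeated with \<zeta> equal to 0.\<close>
  then have "dominated k T (d T) (V a + (1 + 0) * (V T - V a))"
    using a by (intro mean) auto
  then show ?thesis by simp
qed

end

section \<open>Comparison of solutions\<close>

lemma impulsive_solution_on_subset:
  "impulsive_solution_on J \<theta> F G x \<Longrightarrow> J' \<subseteq> J \<Longrightarrow> impulsive_solution_on J' \<theta> F G x"
  unfolding impulsive_solution_on_def
  by (meson Int_mono has_vector_derivative_within_subset order_refl subsetD tendsto_within_subset)

lemma impulsive_solution_on_deriv:
  assumes "impulsive_solution_on J \<theta> F G x" "open J" "t \<in> J" "t \<notin> range \<theta>"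
  shows "(x has_vector_derivative F t (x t)) (at t)"
  using assms at_within_open unfolding impulsive_solution_on_def by metis

lemma impulsive_solution_on_left:
  assumes "impulsive_solution_on J \<theta> F G x" "open J" "t \<in> J"
  shows "(x \<longlongrightarrow> x t) (at_left t)"
proof (cases "t \<in> range \<theta>")
  case False
  from impulsive_solution_on_deriv[OF assms False] have "isCont x t"
    by (rule has_vector_derivative_continuous)
  then show ?thesis
    by (auto simp: continuous_within intro: tendsto_within_subset)
next
  case True
  have "at t within (J \<inter> {..<t}) = at_left t"
    by (rule at_within_nhd[OF assms(3,2)]) auto
  then show ?thesis using True assms unfolding impulsive_solution_on_def by force
qed

lemma impulsive_solution_on_right:
  assumes "impulsive_solution_on J \<theta> F G x" "open J" "t \<in> J"
  shows "\<exists>r. (x \<longlongrightarrow> r) (at_right t)"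
proof (cases "t \<in> range \<theta>")
  case False
  from impulsive_solution_on_deriv[OF assms False] have "isCont x t"
    by (rule has_vector_derivative_continuous)
  then show ?thesis
    by (auto simp: continuous_within intro: tendsto_within_subset)
next
  case True
  then show ?thesis using assms unfolding impulsive_solution_on_def by force
qed

text \<open>The nonlinear differences are recorded as forcing terms that do not depend on the
  unknown, so that a linear comparison applies and needs nothing but norm bounds for them.\<close>

lemma impulsive_solution_on_diff:
  fixes x y :: "real \<Rightarrow> real^'m"
  assumes x: "impulsive_solution_on J \<theta> (\<lambda>t x. A *v x + f t x) (\<lambda>k x. B *v x + g k x) x"
    and y: "impulsive_solution_on J \<theta> (\<lambda>t x. A *v x + f' t x) (\<lambda>k x. B *v x + g' k x) y"
  shows "impulsive_solution_on J \<theta> (\<lambda>t v. A *v v + (f t (x t) - f' t (y t)))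
    (\<lambda>k v. B *v v + (g k (x (\<theta> k)) - g' k (y (\<theta> k)))) (\<lambda>t. x t - y t)"
  unfolding impulsive_solution_on_def
proof (intro conjI allI ballI impI)
  fix t assume "t \<in> J" "t \<notin> range \<theta>"
  then have "(x has_vector_derivative A *v x t + f t (x t)) (at t within J)"
    "(y has_vector_derivative A *v y t + f' t (y t)) (at t within J)"
    using x y by (auto simp: impulsive_solution_on_def)
  from has_vector_derivative_diff[OF this]
  show "((\<lambda>t. x t - y t) has_vector_derivative
      A *v (x t - y t) + (f t (x t) - f' t (y t))) (at t within J)"
    by (simp add: matrix_vector_mult_diff_distrib algebra_simps)
next
  fix k assume k: "\<theta> k \<in> J"
  then show "((\<lambda>t. x t - y t) \<longlongrightarrow> x (\<theta> k) - y (\<theta> k)) (at (\<theta> k) within J \<inter> {..<\<theta> k})"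
    using x y by (auto simp: impulsive_solution_on_def intro!: tendsto_diff)
  obtain r r' where r: "(x \<longlongrightarrow> r) (at_right (\<theta> k))" "r - x (\<theta> k) = B *v x (\<theta> k) + g k (x (\<theta> k))"
    and r': "(y \<longlongrightarrow> r') (at_right (\<theta> k))" "r' - y (\<theta> k) = B *v y (\<theta> k) + g' k (y (\<theta> k))"
    using x y k unfolding impulsive_solution_on_def by blast
  have "r - r' - (x (\<theta> k) - y (\<theta> k)) = (r - x (\<theta> k)) - (r' - y (\<theta> k))" by simp
  also have "\<dots> = B *v (x (\<theta> k) - y (\<theta> k)) + (g k (x (\<theta> k)) - g' k (y (\<theta> k)))"
    unfolding r(2) r'(2) by (simp add: matrix_vector_mult_diff_distrib)
  finally show "\<exists>r. ((\<lambda>t. x t - y t) \<longlongrightarrow> r) (at_right (\<theta> k)) \<and> r - (x (\<theta> k) - y (\<theta> k))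
      = B *v (x (\<theta> k) - y (\<theta> k)) + (g k (x (\<theta> k)) - g' k (y (\<theta> k)))"
    using tendsto_diff[OF r(1) r'(1)] by blast
qed

text \<open>A left continuous function becomes continuous on a closed segment once its value at the
  left end is replaced by the right limit. Both solutions and inputs are treated in this
  way.\<close>

lemma continuous_on_upd_right_limit:
  fixes d :: "real \<Rightarrow> 'a::topological_space"
  assumes "(d \<longlongrightarrow> w) (at_right a)" "(d \<longlongrightarrow> d b) (at_left b)" "a < b"
    and "\<And>s. a < s \<Longrightarrow> s < b \<Longrightarrow> isCont d s"
  shows "continuous_on {a..b} (d(a := w))"
proof (rule continuous_on_IccI)
  have ev: "\<forall>\<^sub>F s in at_right a. d s = (d(a := w)) s"
    by (auto simp: eventually_at_filter)
  show "(d(a := w) \<longlongrightarrow> (d(a := w)) a) (at_right a)"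
    using assms(1) tendsto_cong[OF ev] by (simp add: fun_upd_def)
  have ev: "\<forall>\<^sub>F s in at_left b. d s = (d(a := w)) s"
    unfolding eventually_at_left_field using \<open>a < b\<close> by auto
  show "(d(a := w) \<longlongrightarrow> (d(a := w)) b) (at_left b)"
    using assms(2,3) tendsto_cong[OF ev] by (simp add: fun_upd_def)
  show "(d(a := w)) \<midarrow>s\<rightarrow> (d(a := w)) s" if "a < s" "s < b" for s
  proof -
    have ev: "\<forall>\<^sub>F u in at s. d u = (d(a := w)) u"
      using eventually_neq_at_within[of a s UNIV] by eventually_elim simp
    show ?thesis using assms(4)[OF that] that tendsto_cong[OF ev] by (simp add: isCont_def fun_upd_def)
  qed
qed (use assms in auto)

locale quasilinear = dissipative +
  fixes Lf Lh :: real
  assumes Lf_pos: "Lf > 0" and Lh_pos: "Lh > 0"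
    and rate: "N * Lf + (real p / \<omega>) * ln (1 + N * Lh) < lam"
begin

text \<open>\<open>K\<close> and \<eta> are fixed before the times and the data; this uniformity
  later allows the start to recede to minus infinity. \<open>u\<close> is positive even if the
  initial difference vanishes, since the majorant has to be positive.\<close>

lemma comparison:
  obtains K \<eta> where "K > 0" "\<eta> > 0"
    "\<And>t\<^sub>0 T d r \<rho> u \<epsilon> d\<^sub>0. \<lbrakk>t\<^sub>0 < T;
       impulsive_solution_on {t\<^sub>0<..} \<theta> (\<lambda>t x. A *v x + r t) (\<lambda>k x. B *v x + \<rho> k) d;
       (d \<longlongrightarrow> d\<^sub>0) (at_right t\<^sub>0); norm d\<^sub>0 \<le> u; u > 0; \<epsilon> \<ge> 0;
       \<And>t. t\<^sub>0 < t \<Longrightarrow> t \<le> T \<Longrightarrow> norm (r t) \<le> Lf * norm (d t) + \<epsilon>;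
       \<And>k. t\<^sub>0 < \<theta> k \<Longrightarrow> \<theta> k \<le> T \<Longrightarrow> norm (\<rho> k) \<le> Lh * norm (d (\<theta> k)) + \<epsilon>\<rbrakk>
       \<Longrightarrow> norm (d T) \<le> K * (exp (- \<eta> * (T - t\<^sub>0)) * u + \<epsilon>)"
proof -
  have pp: "real p > 0" using p_pos by simp
  define gap where "gap = lam - (N * Lf + (real p / \<omega>) * ln (1 + N * Lh))"
  have gap: "gap > 0" using rate by (simp add: gap_def)
  \<comment> \<open>Growth allowed to the majorant at an impulse. The excess over
    \<open>1 + N * Lh\<close> pays for the input error there, and the exponent is such that over a
    period the excess amounts to half of \<open>gap\<close>.\<close>
  define \<beta> where "\<beta> = (1 + N * Lh) * exp (\<omega> / real p * (gap / 2))"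
  have NLh: "1 < 1 + N * Lh" using N_ge_1 Lh_pos by simp
  have \<beta>: "1 + N * Lh < \<beta>"
    unfolding \<beta>_def using NLh gap \<omega>_pos pp by simp
  \<comment> \<open>Chosen with \<open>\<kappa> * \<omega> = p * ln \<beta>\<close>: then the
    logarithm of the weight, taken at the moments, is periodic in the index and therefore
    bounded.\<close>
  define \<kappa> where "\<kappa> = real p / \<omega> * ln \<beta>"
  have ln\<beta>: "ln \<beta> = ln (1 + N * Lh) + \<omega> / real p * (gap / 2)"
    unfolding \<beta>_def using NLh by (subst ln_mult) auto
  have \<kappa>: "\<kappa> = real p / \<omega> * ln (1 + N * Lh) + gap / 2"
    unfolding \<kappa>_def ln\<beta> using \<omega>_pos pp by (simp add: distrib_left)
  have \<kappa>_nonneg: "\<kappa> \<ge> 0" unfolding \<kappa>_def using \<omega>_pos \<beta> NLh by simp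
  define \<eta> where "\<eta> = gap / 4"
  have \<eta>: "\<eta> > 0" "lam - \<kappa> - N * Lf = 2 * \<eta>"
    using gap gap_def unfolding \<eta>_def \<kappa> by linarith+
  have "\<exists>C. \<forall>k. \<bar>ln \<beta> * of_int k - \<kappa> * \<theta> k\<bar> \<le> C"
  proof (rule periodic_bounded)
    fix k j
    have "\<kappa> * \<omega> = real p * ln \<beta>" using \<omega>_pos by (simp add: \<kappa>_def)
    then show "ln \<beta> * of_int (k + j * int p) - \<kappa> * \<theta> (k + j * int p)
        = ln \<beta> * of_int k - \<kappa> * \<theta> k"
      by (simp add: shift algebra_simps)
  qed
  then obtain C\<^sub>0 where C\<^sub>0: "\<And>k. \<bar>ln \<beta> * of_int k - \<kappa> * \<theta> k\<bar> \<le> C\<^sub>0" by blast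
  define Pmin where "Pmin = exp (- C\<^sub>0)"
  \<comment> \<open>Within a segment the time lags behind its right end by at most \<omega>, which
    adds \<open>\<kappa> * \<omega>\<close> to the exponent.\<close>
  define Pmax where "Pmax = exp (C\<^sub>0 + \<kappa> * \<omega>)"
  define P where "P k t = exp (ln \<beta> * of_int k - \<kappa> * t)" for k :: int and t
  have P: "Pmin \<le> P k t" "P k t \<le> Pmax" if "\<theta> (k - 1) \<le> t" "t \<le> \<theta> k" for k t
  proof -
    have "\<kappa> * t \<le> \<kappa> * \<theta> k" using that \<kappa>_nonneg by (rule_tac mult_left_mono) auto
    moreover have "\<kappa> * (\<theta> k - t) \<le> \<kappa> * \<omega>"
      using that \<kappa>_nonneg step_le[of k] by (intro mult_left_mono) auto
    ultimately show "Pmin \<le> P k t" "P k t \<le> Pmax"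
      using C\<^sub>0[of k] unfolding Pmin_def P_def Pmax_def exp_le_cancel_iff
      by (auto simp: right_diff_distrib abs_le_iff)
  qed
  have Ppos: "Pmin > 0" "Pmax > 0" "\<And>k t. P k t > 0" by (auto simp: Pmin_def Pmax_def P_def)
  \<comment> \<open>The first summand lets \<open>C * \<epsilon>\<close> absorb the input error
    along segments, the second lets it absorb the input error at impulses.\<close>
  define C where "C = N / (2 * \<eta> * Pmin) + N / ((\<beta> - (1 + N * Lh)) * Pmin)"
  have C: "C \<ge> N / (2 * \<eta> * Pmin)" "C \<ge> N / ((\<beta> - (1 + N * Lh)) * Pmin)" "C > 0"
    using \<eta> \<beta> Ppos N_ge_1 by (auto simp: C_def intro!: add_pos_pos)
  have C\<eta>: "N \<le> 2 * \<eta> * Pmin * C" using C(1) \<eta> Ppos by (simp add: pos_divide_le_eq mult_ac)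
  have C\<beta>: "N \<le> (\<beta> - (1 + N * Lh)) * Pmin * C"
    using C(2) \<beta> Ppos by (simp add: pos_divide_le_eq mult_ac)
  define K where "K = Pmax * (N / Pmin) + Pmax * C"
  have K_pos: "K > 0" unfolding K_def using Ppos N_ge_1 C by (intro add_pos_pos) auto
  have main: "norm (d T) \<le> K * (exp (- \<eta> * (T - t\<^sub>0)) * u + \<epsilon>)"
    if T: "t\<^sub>0 < T"
      and sol: "impulsive_solution_on {t\<^sub>0<..} \<theta> (\<lambda>t x. A *v x + r t) (\<lambda>k x. B *v x + \<rho> k) d"
      and d0: "(d \<longlongrightarrow> d\<^sub>0) (at_right t\<^sub>0)" "norm d\<^sub>0 \<le> u" "u > 0" and \<epsilon>: "\<epsilon> \<ge> 0"
      and r: "\<And>t. t\<^sub>0 < t \<Longrightarrow> t \<le> T \<Longrightarrow> norm (r t) \<le> Lf * norm (d t) + \<epsilon>"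
      and \<rho>: "\<And>k. t\<^sub>0 < \<theta> k \<Longrightarrow> \<theta> k \<le> T \<Longrightarrow> norm (\<rho> k) \<le> Lh * norm (d (\<theta> k)) + \<epsilon>"
    for t\<^sub>0 T d r \<rho> u \<epsilon> d\<^sub>0
  proof -
    \<comment> \<open>Makes the majorant at the start at least
      \<open>N * exp (lam * t\<^sub>0) * u\<close>, because the weight is at least
      \<open>Pmin\<close>.\<close>
    define z where "z = N * u / Pmin"
    define Z where "Z s = z * exp (- \<eta> * (s - t\<^sub>0))" for s
    have Z_pos: "Z s > 0" for s unfolding Z_def z_def using N_ge_1 d0 Ppos by simp
    \<comment> \<open>The part with \<open>Z\<close> carries the fading initial difference, the part
      \<open>C * \<epsilon>\<close> the permanent effect of the input error.\<close>
    define V where "V k s = exp (lam * s) * P k s * (Z s + C * \<epsilon>)" for k s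
    define V' where "V' k s = exp (lam * s) * P k s * ((lam - \<kappa>) * (Z s + C * \<epsilon>) - \<eta> * Z s)" for k s
    have V: "(V k has_real_derivative V' k s) (at s)" for k s
      unfolding V_def P_def Z_def
      by (rule derivative_eq_intros refl)+ (simp add: V'_def P_def Z_def algebra_simps)
    have Z\<epsilon>: "Z s + C * \<epsilon> > 0" for s using Z_pos C \<epsilon> by (simp add: add_pos_nonneg)
    have V_pos: "V k s > 0" for k s unfolding V_def using Z\<epsilon> Ppos by simp
    \<comment> \<open>The growth of \<open>V\<close> exceeds the need by the rate
      \<open>2 * \<eta>\<close>. On \<open>Z\<close> half of this pays for the decay of
      \<open>Z\<close>; on \<open>C * \<epsilon>\<close> all of it pays for the input error.\<close>
    have V_super: "N * (Lf * V k s + \<epsilon> * exp (lam * s)) \<le> V' k s"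
      if "\<theta> (k - 1) \<le> s" "s \<le> \<theta> k" for k s
    proof -
      have "N * \<epsilon> \<le> (2 * \<eta> * Pmin * C) * \<epsilon>" using C\<eta> \<epsilon> by (rule mult_right_mono)
      also have "\<dots> = Pmin * (2 * \<eta> * C * \<epsilon>)" by simp
      also have "\<dots> \<le> P k s * (2 * \<eta> * C * \<epsilon> + \<eta> * Z s)"
        using P[OF that] \<eta> C \<epsilon> Ppos Z_pos[of s] by (intro mult_mono) auto
      also have "\<dots> = P k s * ((lam - \<kappa> - N * Lf) * (Z s + C * \<epsilon>) - \<eta> * Z s)"
        unfolding \<eta>(2) by (simp add: algebra_simps)
      finally have "exp (lam * s) * (N * \<epsilon>)
          \<le> exp (lam * s) * (P k s * ((lam - \<kappa> - N * Lf) * (Z s + C * \<epsilon>) - \<eta> * Z s))"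
        by (rule mult_left_mono) simp
      then show ?thesis unfolding V_def V'_def by (simp add: algebra_simps)
    qed
    obtain k\<^sub>0 where k\<^sub>0: "\<theta> (k\<^sub>0 - 1) \<le> t\<^sub>0" "t\<^sub>0 < \<theta> k\<^sub>0" using ex_segment_right by blast
    define a where "a k = max t\<^sub>0 (\<theta> (k - 1))" for k
    have isCont: "isCont d s" if "t\<^sub>0 < s" "s \<notin> range \<theta>" for s
      using impulsive_solution_on_deriv[OF sol] that
      by (auto intro: has_vector_derivative_continuous)
    have segment: "dominated k T' (d T') (V k T')"
      if w: "(d \<longlongrightarrow> w) (at_right (a k))" "dominated k (a k) w (V k (a k))"
        and T': "a k < T'" "T' \<le> \<theta> k" "T' \<le> T" for k w T'
    proof -
      have ak: "t\<^sub>0 \<le> a k" "\<theta> (k - 1) \<le> a k" by (auto simp: a_def)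
      have nm: "s \<notin> range \<theta>" if "a k < s" "s < T'" for s
        using not_moment[of k s] that ak T' by auto
      let ?d = "d(a k := w)"
      have "dominated k T' (?d T') (V k T')"
      proof (rule dominated_segment)
        show "continuous_on {a k..T'} ?d"
          using w T' ak nm isCont impulsive_solution_on_left[OF sol, of T']
          by (intro continuous_on_upd_right_limit) auto
        show "(?d has_vector_derivative A *v ?d s + r s) (at s)" if s: "a k < s" "s < T'" for s
        proof (rule has_vector_derivative_transform_within_open)
          show "(d has_vector_derivative A *v ?d s + r s) (at s)"
            using impulsive_solution_on_deriv[OF sol, of s] s ak nm by simp
        qed (use s in \<open>auto intro: open_greaterThan[of "a k"]\<close>)
        show "norm (r s) \<le> Lf * norm (?d s) + \<epsilon>" if "a k < s" "s < T'" for s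
          using r[of s] that T' ak by simp
        show "N * (Lf * V k s + \<epsilon> * exp (lam * s)) \<le> V' k s" if "a k < s" "s < T'" for s
          using V_super[of k s] that T' ak by simp
      qed (use w T' ak \<epsilon> Lf_pos V V_pos in auto)
      then show ?thesis using T' by simp
    qed
    \<comment> \<open>Here \<open>w\<close> is the state just after the impulse that opens segment
      \<open>k\<close>, or the initial value. The premise keeps the induction within the range in
      which the forcing is controlled.\<close>
    have start: "\<theta> (k - 1) < T \<longrightarrow>
        (\<exists>w. (d \<longlongrightarrow> w) (at_right (a k)) \<and> dominated k (a k) w (V k (a k)))" if "k\<^sub>0 \<le> k" for k
      using that
    proof (induction k rule: int_ge_induct)
      case base
      have a: "a k\<^sub>0 = t\<^sub>0" using k\<^sub>0 by (simp add: a_def)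
      have "N * norm d\<^sub>0 \<le> P k\<^sub>0 t\<^sub>0 / Pmin * (N * u)"
        using P[of k\<^sub>0 t\<^sub>0] k\<^sub>0 Ppos d0 N_ge_1 mult_mono[of 1 "P k\<^sub>0 t\<^sub>0 / Pmin" "N * norm d\<^sub>0" "N * u"]
        by simp
      also have "\<dots> \<le> P k\<^sub>0 t\<^sub>0 * (Z t\<^sub>0 + C * \<epsilon>)"
        using C \<epsilon> Ppos less_imp_le[OF Ppos(3)] by (simp add: Z_def z_def distrib_left)
      finally have "exp (lam * t\<^sub>0) * (N * norm d\<^sub>0) \<le> V k\<^sub>0 t\<^sub>0"
        unfolding V_def mult.assoc by (rule mult_left_mono) simp
      then have "dominated k\<^sub>0 t\<^sub>0 d\<^sub>0 (V k\<^sub>0 t\<^sub>0)"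
        using dominatedI_norm[of k\<^sub>0 t\<^sub>0 d\<^sub>0] k\<^sub>0
        by (intro dominated_mono[OF dominatedI_norm]) (auto simp: mult_ac)
      then show ?case using d0 a by auto
    next
      case (step k)
      show ?case
      proof
        assume less: "\<theta> (k + 1 - 1) < T"
        have "\<theta> (k - 1) < \<theta> k" by (simp add: less_iff)
        with less step.IH obtain w where w: "(d \<longlongrightarrow> w) (at_right (a k))"
          "dominated k (a k) w (V k (a k))" by auto
        have "t\<^sub>0 < \<theta> k" using k\<^sub>0 step le_iff[of k\<^sub>0 k] by simp
        then have a: "a k < \<theta> k" "a (k + 1) = \<theta> k" using \<open>\<theta> (k - 1) < \<theta> k\<close> by (auto simp: a_def)
        have dom: "dominated k (\<theta> k) (d (\<theta> k)) (V k (\<theta> k))"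
          using a less by (intro segment[OF w]) auto
        obtain w' where w': "(d \<longlongrightarrow> w') (at_right (\<theta> k))" "w' - d (\<theta> k) = B *v d (\<theta> k) + \<rho> k"
          using sol \<open>t\<^sub>0 < \<theta> k\<close> unfolding impulsive_solution_on_def by auto
        have "exp (lam * \<theta> k) * norm (d (\<theta> k)) \<le> V k (\<theta> k)"
          using dominated_imp_norm_le[OF dom] \<open>\<theta> (k - 1) < \<theta> k\<close> by simp
        have "N * exp (lam * \<theta> k) * norm (\<rho> k)
            \<le> N * exp (lam * \<theta> k) * (Lh * norm (d (\<theta> k)) + \<epsilon>)"
          using \<rho>[of k] \<open>t\<^sub>0 < \<theta> k\<close> less N_ge_1 by (intro mult_left_mono) auto
        also have "\<dots> = N * Lh * (exp (lam * \<theta> k) * norm (d (\<theta> k))) + exp (lam * \<theta> k) * (N * \<epsilon>)"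
          by (simp add: algebra_simps)
        \<comment> \<open>By the choice of \<open>C\<close>, the room
          \<open>\<beta> - (1 + N * Lh)\<close> times the majorant covers
          \<open>N * \<epsilon>\<close>. The sum is then exactly what \<open>V\<close> gains when
          its index goes up by one.\<close>
        also have "\<dots> \<le> N * Lh * V k (\<theta> k) + exp (lam * \<theta> k) *
            (P k (\<theta> k) * ((\<beta> - (1 + N * Lh)) * (Z (\<theta> k) + C * \<epsilon>)))"
        proof (intro add_mono mult_left_mono)
          have "N * \<epsilon> \<le> (\<beta> - (1 + N * Lh)) * Pmin * C * \<epsilon>" using C\<beta> \<epsilon> by (rule mult_right_mono)
          also have "\<dots> = Pmin * ((\<beta> - (1 + N * Lh)) * (C * \<epsilon>))" by simp
          also have "\<dots> \<le> P k (\<theta> k) * ((\<beta> - (1 + N * Lh)) * (Z (\<theta> k) + C * \<epsilon>))"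
            using P[of k "\<theta> k"] \<open>\<theta> (k - 1) < \<theta> k\<close> \<beta> C \<epsilon> Ppos Z_pos[of "\<theta> k"]
            by (intro mult_mono) auto
          finally show "N * \<epsilon> \<le> P k (\<theta> k) * ((\<beta> - (1 + N * Lh)) * (Z (\<theta> k) + C * \<epsilon>))" .
        qed (use N_ge_1 Lh_pos in \<open>auto intro: \<open>exp (lam * \<theta> k) * norm (d (\<theta> k)) \<le> V k (\<theta> k)\<close>\<close>)
        also have "\<dots> = \<beta> * V k (\<theta> k) - V k (\<theta> k)"
          by (simp add: V_def algebra_simps)
        also have "\<beta> * V k (\<theta> k) = V (k + 1) (\<theta> k)"
        proof -
          have "P (k + 1) (\<theta> k) = \<beta> * P k (\<theta> k)"
            using \<beta> NLh by (simp add: P_def exp_add exp_diff distrib_left)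
          then show ?thesis by (simp add: V_def)
        qed
        finally have jump: "V k (\<theta> k) + N * exp (lam * \<theta> k) * norm (\<rho> k) \<le> V (k + 1) (\<theta> k)"
          by simp
        have "dominated (k + 1) (\<theta> k) ((d (\<theta> k) + B *v d (\<theta> k)) + \<rho> k)
            (V k (\<theta> k) + N * exp (lam * \<theta> k) * norm (\<rho> k))"
          by (intro dominated_add dominated_jump dom dominatedI_norm) (simp_all add: le_iff)
        moreover have "(d (\<theta> k) + B *v d (\<theta> k)) + \<rho> k = w'"
          using w'(2) by (simp add: algebra_simps)
        ultimately show "\<exists>w. (d \<longlongrightarrow> w) (at_right (a (k + 1)))
            \<and> dominated (k + 1) (a (k + 1)) w (V (k + 1) (a (k + 1)))"
          using w'(1) dominated_mono[OF _ jump] a by auto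
      qed
    qed
    define k where "k = idx T"
    have k: "\<theta> (k - 1) < T" "T \<le> \<theta> k" using idx[of T] by (auto simp: k_def)
    have "\<theta> (k\<^sub>0 - 1) < \<theta> k" using k k\<^sub>0 T by linarith
    then have "k\<^sub>0 \<le> k" by (simp add: less_iff)
    with start k obtain w where "(d \<longlongrightarrow> w) (at_right (a k))" "dominated k (a k) w (V k (a k))"
      by blast
    then have "dominated k T (d T) (V k T)" using k T by (intro segment) (auto simp: a_def)
    then have "exp (lam * T) * norm (d T) \<le> V k T"
      using k by (intro dominated_imp_norm_le) auto
    then have "norm (d T) \<le> P k T * (Z T + C * \<epsilon>)" by (simp add: V_def mult.assoc)
    also have "\<dots> \<le> Pmax * (Z T + C * \<epsilon>)"
      using P[of k T] k less_imp_le[OF Z\<epsilon>] by (intro mult_right_mono) auto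
    also have "\<dots> \<le> K * (exp (- \<eta> * (T - t\<^sub>0)) * u + \<epsilon>)"
      using Ppos C \<epsilon> N_ge_1 d0 by (simp add: K_def Z_def z_def algebra_simps add_nonneg_nonneg)
    finally show ?thesis .
  qed
  show thesis by (rule that[OF K_pos \<eta>(1)]) (rule main; assumption)
qed

end

section \<open>Existence of solutions\<close>

text \<open>The weight \<open>exp (-2 L (t - a))\<close> makes the Picard operator a contraction on the whole interval.\<close>

lemma picard_lindeloef_global:
  fixes F :: "real \<Rightarrow> 'a::euclidean_space \<Rightarrow> 'a"
  assumes "a < b" and L: "L > 0"
    and cont: "continuous_on ({a..b} \<times> UNIV) (\<lambda>(t, x). F t x)"
    and lip: "\<And>t x y. a \<le> t \<Longrightarrow> t \<le> b \<Longrightarrow> norm (F t x - F t y) \<le> L * norm (x - y)"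
  obtains x where "x a = v" "\<And>t. a \<le> t \<Longrightarrow> t \<le> b \<Longrightarrow>
    (x has_vector_derivative F t (x t)) (at t within {a..b})"
proof -
  define w where "w t = exp (2 * L * (t - a))" for t
  have w_pos: "w t > 0" for t by (simp add: w_def)
  have w_cont: "continuous_on S w" for S unfolding w_def by (intro continuous_intros)
  \<comment> \<open>Clamping to \<open>{a..b}\<close> extends the iterates to bounded continuous
    functions on the line, a complete space in which the fixed point theorem applies.\<close>
  define c where "c t = max a (min b t)" for t
  have c: "a \<le> c t" "c t \<le> b" "a \<le> t \<Longrightarrow> t \<le> b \<Longrightarrow> c t = t" for t
    using \<open>a < b\<close> by (auto simp: c_def)
  have c_cont: "continuous_on S c" for S unfolding c_def by (intro continuous_intros)
  \<comment> \<open>The unknown \<open>y\<close> is the solution divided by the weight, so the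
    supremum distance of the \<open>y\<close> is the weighted distance of the solutions.\<close>
  define g where "g y s = F s (w s *\<^sub>R apply_bcontfun y s)" for y :: "real \<Rightarrow>\<^sub>C 'a" and s
  have g_cont: "continuous_on {a..b} (g y)" for y
  proof -
    have "continuous_on {a..b} (\<lambda>s. (s, w s *\<^sub>R apply_bcontfun y s))"
      by (intro continuous_on_Pair continuous_on_scaleR continuous_on_id w_cont
          continuous_on_apply_bcontfun)
    from continuous_on_compose2[OF cont this] show ?thesis
      unfolding g_def by (simp add: image_subset_iff)
  qed
  have g_int: "g y integrable_on {a..t}" if "t \<le> b" for y t
    by (intro integrable_continuous_real continuous_on_subset[OF g_cont]) (use that in auto)
  define T where "T y t = inverse (w (c t)) *\<^sub>R (v + integral {a..c t} (g y))" for y t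
  have T_cont: "continuous_on UNIV (T y)" for y
  proof -
    have "continuous_on {a..b} (\<lambda>t. integral {a..t} (g y))"
      by (rule indefinite_integral_continuous_1[OF g_int]) simp
    then have "continuous_on UNIV (\<lambda>t. integral {a..c t} (g y))"
      by (rule continuous_on_compose2[OF _ c_cont]) (use c in auto)
    moreover have "continuous_on UNIV (\<lambda>t. w (c t))"
      by (rule continuous_on_compose2[OF w_cont c_cont]) auto
    ultimately show ?thesis
      unfolding T_def using w_pos by (intro continuous_intros) (auto simp: less_imp_neq[symmetric])
  qed
  have T_bcont: "T y \<in> bcontfun" for y
  proof -
    have "compact (T y ` {a..b})"
      by (intro compact_continuous_image continuous_on_subset[OF T_cont]) auto
    moreover have "range (T y) \<subseteq> T y ` {a..b}"
    proof clarify
      fix t show "T y t \<in> T y ` {a..b}"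
        using c[of t] c(3)[of "c t"] by (intro image_eqI[of _ _ "c t"]) (auto simp: T_def)
    qed
    ultimately have "bounded (range (T y))" by (rule bounded_subset[OF compact_imp_bounded])
    with T_cont show ?thesis by (simp add: bcontfun_def)
  qed
  define \<Phi> where "\<Phi> y = Bcontfun (T y)" for y
  have \<Phi>: "apply_bcontfun (\<Phi> y) = T y" for y
    unfolding \<Phi>_def by (rule Bcontfun_inverse[OF T_bcont])
  have "dist (\<Phi> y) (\<Phi> z) \<le> 1/2 * dist y z" for y z
  proof (rule dist_bound)
    fix t
    let ?D = "dist y z" and ?t = "c t"
    have "norm (integral {a..?t} (g y) - integral {a..?t} (g z)) \<le> integral {a..?t} (\<lambda>s. L * ?D * w s)"
    proof (subst integral_diff[symmetric])
      show "norm (integral {a..?t} (\<lambda>s. g y s - g z s)) \<le> integral {a..?t} (\<lambda>s. L * ?D * w s)"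
      proof (rule integral_norm_bound_integral)
        show "(\<lambda>s. g y s - g z s) integrable_on {a..?t}"
          by (intro integrable_diff g_int c)
        show "(\<lambda>s. L * ?D * w s) integrable_on {a..?t}"
          by (intro integrable_continuous_real continuous_intros w_cont)
        fix s assume s: "s \<in> {a..?t}"
        have "norm (g y s - g z s) \<le> L * norm (w s *\<^sub>R apply_bcontfun y s - w s *\<^sub>R apply_bcontfun z s)"
          unfolding g_def using s c(2)[of t] by (intro lip) auto
        also have "\<dots> = L * (w s * dist (apply_bcontfun y s) (apply_bcontfun z s))"
          using w_pos[of s] by (simp add: dist_norm flip: scaleR_diff_right)
        also have "\<dots> \<le> L * (w s * ?D)"
          using L w_pos[of s] dist_bounded by (intro mult_left_mono) auto
        finally show "norm (g y s - g z s) \<le> L * ?D * w s" by (simp add: mult_ac)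
      qed
    qed (intro g_int c)+
    \<comment> \<open>A primitive of \<open>L * w\<close> is \<open>w / 2\<close>: the exponent
      \<open>2 * L\<close> is what gives the contraction factor 1/2.\<close>
    also have "\<dots> = ?D / 2 * w ?t - ?D / 2 * w a"
    proof (rule integral_unique, rule fundamental_theorem_of_calculus)
      fix s
      show "((\<lambda>s. ?D / 2 * w s) has_vector_derivative L * ?D * w s) (at s within {a..?t})"
        unfolding w_def has_real_derivative_iff_has_vector_derivative[symmetric]
        by (rule derivative_eq_intros refl)+ simp
    qed (rule c)
    also have "\<dots> \<le> ?D / 2 * w ?t" using w_pos[of a] by simp
    finally have le: "norm (integral {a..?t} (g y) - integral {a..?t} (g z)) \<le> ?D / 2 * w ?t" .
    have "dist (T y t) (T z t)
        = inverse (w ?t) * norm (integral {a..?t} (g y) - integral {a..?t} (g z))"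
      using w_pos[of ?t] by (simp add: T_def dist_norm flip: scaleR_diff_right)
    also have "\<dots> \<le> inverse (w ?t) * (?D / 2 * w ?t)"
      using w_pos[of ?t] by (intro mult_left_mono le) simp
    also have "\<dots> = 1/2 * ?D" using w_pos[of ?t] by simp
    finally show "dist (apply_bcontfun (\<Phi> y) t) (apply_bcontfun (\<Phi> z) t) \<le> 1/2 * ?D"
      by (simp only: \<Phi>)
  qed
  then have "\<exists>!y. \<Phi> y = y" by (intro banach_fix_type[of "1/2"]) auto
  then obtain y where y: "\<Phi> y = y" by blast
  define x where "x t = w t *\<^sub>R apply_bcontfun y t" for t
  have x: "x t = v + integral {a..t} (\<lambda>s. F s (x s))" if "a \<le> t" "t \<le> b" for t
  proof -
    have "apply_bcontfun y t = T y t" using y \<Phi> by metis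
    then have "x t = v + integral {a..t} (g y)"
      using w_pos[of t] that by (simp add: x_def T_def c)
    then show ?thesis by (simp add: g_def[abs_def] x_def)
  qed
  show thesis
  proof
    show "x a = v" using x[of a] \<open>a < b\<close> by simp
    fix t assume t: "a \<le> t" "t \<le> b"
    have "continuous_on {a..b} (\<lambda>s. F s (x s))"
      using g_cont[of y] by (simp add: g_def[abs_def] x_def)
    from integral_has_vector_derivative[OF this, of t] t
    have "((\<lambda>u. v + integral {a..u} (\<lambda>s. F s (x s))) has_vector_derivative F t (x t)) (at t within {a..b})"
      by (auto intro!: derivative_eq_intros)
    then show "(x has_vector_derivative F t (x t)) (at t within {a..b})"
      by (rule has_vector_derivative_transform[rotated 2]) (use t x in auto)
  qed
qed

lemma exp_decay:
  fixes C \<eta> e :: real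
  assumes "C > 0" "\<eta> > 0" "e > 0"
  obtains \<tau>\<^sub>0 where "\<And>\<tau>. \<tau> \<ge> \<tau>\<^sub>0 \<Longrightarrow> C * exp (- \<eta> * \<tau>) < e"
proof
  fix \<tau> assume "\<tau> \<ge> (1 - ln (e / C)) / \<eta>"
  then have "- \<eta> * \<tau> < ln (e / C)" using assms by (simp add: pos_divide_le_eq mult.commute)
  then have "exp (- \<eta> * \<tau>) < e / C"
    using assms by (metis divide_pos_pos exp_less_cancel_iff exp_ln)
  then show "C * exp (- \<eta> * \<tau>) < e" using assms by (simp add: field_simps)
qed

lemma impulsive_solution_on_cong:
  assumes sol: "impulsive_solution_on J \<theta> F G x" and J: "open J"
    and eq: "\<And>t. t \<in> J \<Longrightarrow> x t = y t"
  shows "impulsive_solution_on J \<theta> F G y"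
  unfolding impulsive_solution_on_def
proof (intro conjI ballI allI impI)
  fix t assume t: "t \<in> J" "t \<notin> range \<theta>"
  have "(x has_vector_derivative F t (x t)) (at t within J)"
    using sol t by (simp add: impulsive_solution_on_def)
  then show "(y has_vector_derivative F t (y t)) (at t within J)"
    unfolding eq[OF t(1)] by (rule has_vector_derivative_transform[rotated 2]) (use t eq in auto)
next
  fix k assume k: "\<theta> k \<in> J"
  have "\<forall>\<^sub>F t in nhds (\<theta> k). t \<in> J" using J k by (rule eventually_nhds_in_open)
  then have ev: "\<forall>\<^sub>F t in at (\<theta> k) within S. x t = y t" for S
    unfolding eventually_at_filter by eventually_elim (simp add: eq)
  show "(y \<longlongrightarrow> y (\<theta> k)) (at (\<theta> k) within J \<inter> {..<\<theta> k})"
    using sol k eq[OF k] tendsto_cong[OF ev] by (auto simp: impulsive_solution_on_def)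
  show "\<exists>r. (y \<longlongrightarrow> r) (at_right (\<theta> k)) \<and> r - y (\<theta> k) = G k (y (\<theta> k))"
    using sol k eq[OF k] tendsto_cong[OF ev] unfolding impulsive_solution_on_def by metis
qed

context impulse_sequence
begin

lemma impulsive_solution_on_UNIV_I:
  assumes "\<And>k. impulsive_solution_on {\<theta> k<..} \<theta> F G x"
  shows "impulsive_solution_on UNIV \<theta> F G x"
  unfolding impulsive_solution_on_def
proof (intro conjI ballI allI impI)
  fix t assume "t \<notin> range \<theta>"
  then show "(x has_vector_derivative F t (x t)) (at t)"
    using impulsive_solution_on_deriv[OF assms[of "idx t - 1"]] idx[of t] by simp
next
  fix k
  have "impulsive_solution_on {\<theta> (k - 1)<..} \<theta> F G x" "\<theta> (k - 1) < \<theta> k"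
    using assms by (auto simp: less_iff)
  then show "(x \<longlongrightarrow> x (\<theta> k)) (at (\<theta> k) within UNIV \<inter> {..<\<theta> k})"
    "\<exists>r. (x \<longlongrightarrow> r) (at_right (\<theta> k)) \<and> r - x (\<theta> k) = G k (x (\<theta> k))"
    using impulsive_solution_on_left[of "{\<theta> (k - 1)<..}" \<theta> F G x "\<theta> k"]
    by (auto simp: impulsive_solution_on_def)
qed

end

locale quasilinear_system = quasilinear p \<omega> \<theta> A B N lam Lf Lh
  for p \<omega> \<theta> and A B :: "real^'m^'m" and N lam Lf Lh +
  fixes f :: "real \<Rightarrow> real^'m \<Rightarrow> real^'m" and h :: "real^'m \<Rightarrow> real^'m" and Mf Mh :: real
  assumes f_cont: "continuous_on UNIV (\<lambda>(t, x). f t x)"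
    and f_periodic: "\<And>t x. f (t + \<omega>) x = f t x"
    and f_le_period: "\<And>t x. t \<in> {0..<\<omega>} \<Longrightarrow> norm (f t x) \<le> Mf" and h_le: "\<And>x. norm (h x) \<le> Mh"
    and f_lip: "\<And>t x y. norm (f t x - f t y) \<le> Lf * norm (x - y)"
    and h_lip: "\<And>x y. norm (h x - h y) \<le> Lh * norm (x - y)"
begin

lemma f_shift: "f (t + of_int j * \<omega>) x = f t x"
proof (induction j rule: int_induct[where k = 0])
  case (step1 i)
  then show ?case using f_periodic[of "t + of_int i * \<omega>"] by (simp add: algebra_simps)
next
  case (step2 i)
  then show ?case using f_periodic[of "t + of_int (i - 1) * \<omega>"] by (simp add: algebra_simps)
qed simp

lemma f_le: "norm (f t x) \<le> Mf"
proof -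
  define j where "j = \<lfloor>t / \<omega>\<rfloor>"
  have "of_int j \<le> t / \<omega>" "t / \<omega> < of_int j + 1" unfolding j_def by linarith+
  then have "t + of_int (- j) * \<omega> \<in> {0..<\<omega>}"
    using \<omega>_pos by (simp add: pos_le_divide_eq pos_divide_less_eq distrib_right)
  then show ?thesis using f_le_period f_shift by metis
qed

text \<open>Only the inputs \<open>g\<close> and \<gamma> vary in what follows. They are grouped
  with \<open>f\<close> and \<open>h\<close>, apart from the linear part, to match
  \<open>impulsive_solution_on_diff\<close>.\<close>

abbreviation is_solution ::
  "real set \<Rightarrow> (real \<Rightarrow> real^'m) \<Rightarrow> (int \<Rightarrow> real^'m) \<Rightarrow> (real \<Rightarrow> real^'m) \<Rightarrow> bool" where
  "is_solution J g \<gamma> \<equiv>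
     impulsive_solution_on J \<theta> (\<lambda>t x. A *v x + (f t x + g t)) (\<lambda>k x. B *v x + (h x + \<gamma> k))"

text \<open>The input may jump at the left end; with its right limit there instead, the right-hand
  side is continuous on the closed segment and unchanged inside. The prescribed \<open>v\<close> is
  the state just after the impulse.\<close>

lemma segment_solution:
  assumes "g \<in> BPC \<theta>"
  obtains y where "(y \<longlongrightarrow> v) (at_right (\<theta> (k - 1)))"
    "(y \<longlongrightarrow> y (\<theta> k)) (at_left (\<theta> k))"
    "\<And>t. \<theta> (k - 1) < t \<Longrightarrow> t < \<theta> k \<Longrightarrow>
      (y has_vector_derivative A *v y t + (f t (y t) + g t)) (at t)"
proof -
  let ?a = "\<theta> (k - 1)" and ?b = "\<theta> k"
  have ab: "?a < ?b" by (simp add: less_iff)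
  obtain r where r: "(g \<longlongrightarrow> r) (at_right ?a)" using assms by (auto simp: BPC_def)
  have g: "continuous_on {?a..?b} (g(?a := r))"
    using r assms ab by (intro continuous_on_upd_right_limit)
      (auto simp: BPC_def continuous_on_eq_continuous_at)
  define F where "F t x = A *v x + (f t x + (g(?a := r)) t)" for t x
  obtain y where y: "y ?a = v"
    "\<And>t. ?a \<le> t \<Longrightarrow> t \<le> ?b \<Longrightarrow> (y has_vector_derivative F t (y t)) (at t within {?a..?b})"
  proof (rule picard_lindeloef_global[of ?a ?b "spectral_norm A + Lf" F v])
    have A: "0 \<le> spectral_norm A" unfolding spectral_norm_def by (rule onorm_pos_le) simp
    then show "0 < spectral_norm A + Lf" using Lf_pos by simp
    have "continuous_on ({?a..?b} \<times> UNIV) (\<lambda>z. A *v snd z)"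
      by (intro bounded_linear.continuous_on[OF matrix_vector_mul_bounded_linear] continuous_intros)
    moreover have "continuous_on ({?a..?b} \<times> UNIV) (\<lambda>z::real \<times> (real^'m). (g(?a := r)) (fst z))"
      by (rule continuous_on_compose2[OF g]) (auto intro!: continuous_intros)
    moreover have "continuous_on ({?a..?b} \<times> UNIV) (\<lambda>z. f (fst z) (snd z))"
      using continuous_on_subset[OF f_cont] by (simp add: case_prod_beta')
    ultimately show "continuous_on ({?a..?b} \<times> UNIV) (\<lambda>(t, x). F t x)"
      unfolding F_def case_prod_beta' by (intro continuous_intros)
    fix t x y
    have "norm (F t x - F t y) \<le> norm (A *v (x - y)) + norm (f t x - f t y)"
      unfolding F_def by (rule order_trans[OF _ norm_triangle_ineq])
        (simp add: matrix_vector_mult_diff_distrib algebra_simps)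
    then show "norm (F t x - F t y) \<le> (spectral_norm A + Lf) * norm (x - y)"
      using norm_matrix_vector_mult_le[of A "x - y"] f_lip[of t x y] by (simp add: distrib_right)
  qed (use ab that in auto)
  have cont: "continuous_on {?a..?b} y"
    using y(2) by (auto intro!: has_vector_derivative_continuous simp: continuous_on_eq_continuous_within)
  show thesis
  proof (rule that)
    show "(y \<longlongrightarrow> v) (at_right ?a)" "(y \<longlongrightarrow> y ?b) (at_left ?b)"
      using continuous_on_Icc_at_rightD[OF cont ab] continuous_on_Icc_at_leftD[OF cont ab] y(1)
      by auto
    fix t assume t: "?a < t" "t < ?b"
    have "at t within {?a..?b} = at t"
      using t by (intro at_within_interior) (simp add: interior_cbox[where 'a = real, simplified])
    then show "(y has_vector_derivative A *v y t + (f t (y t) + g t)) (at t)"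
      using y(2)[of t] t by (simp add: F_def)
  qed
qed

lemma solution_exists:
  assumes g: "g \<in> BPC \<theta>"
  shows "\<exists>x. is_solution {\<theta> (k\<^sub>0 - 1)<..} g \<gamma> x \<and> (x \<longlongrightarrow> v) (at_right (\<theta> (k\<^sub>0 - 1)))"
proof -
  have "\<forall>k v. \<exists>y. (y \<longlongrightarrow> v) (at_right (\<theta> (k - 1))) \<and> (y \<longlongrightarrow> y (\<theta> k)) (at_left (\<theta> k)) \<and>
    (\<forall>t. \<theta> (k - 1) < t \<longrightarrow> t < \<theta> k \<longrightarrow>
      (y has_vector_derivative A *v y t + (f t (y t) + g t)) (at t))"
    using segment_solution[OF g] by metis
  then obtain Y where Y: "\<And>k v. (Y k v \<longlongrightarrow> v) (at_right (\<theta> (k - 1)))"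
    "\<And>k v. (Y k v \<longlongrightarrow> Y k v (\<theta> k)) (at_left (\<theta> k))"
    "\<And>k v t. \<theta> (k - 1) < t \<Longrightarrow> t < \<theta> k \<Longrightarrow>
      (Y k v has_vector_derivative A *v Y k v t + (f t (Y k v t) + g t)) (at t)"
    by metis
  \<comment> \<open>\<open>V n\<close> is the state just after the moment with index
    \<open>k\<^sub>0 + n - 1\<close>; in particular \<open>V 0\<close> is the prescribed right
    limit.\<close>
  define V where "V = rec_nat v (\<lambda>n w. let k = k\<^sub>0 + int n; y = Y k w (\<theta> k) in y + (B *v y + (h y + \<gamma> k)))"
  define x where "x t = Y (idx t) (V (nat (idx t - k\<^sub>0))) t" for t
  have x: "x t = Y k (V (nat (k - k\<^sub>0))) t" if "\<theta> (k - 1) < t" "t \<le> \<theta> k" for k t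
    using idx_eqI[OF that] by (simp add: x_def)
  have x_right: "(x \<longlongrightarrow> V (nat (k - k\<^sub>0))) (at_right (\<theta> (k - 1)))" for k
  proof -
    have "\<theta> (k - 1) < \<theta> k" by (simp add: less_iff)
    then have "\<forall>\<^sub>F t in at_right (\<theta> (k - 1)). x t = Y k (V (nat (k - k\<^sub>0))) t"
      unfolding eventually_at_right_field using x by (intro exI[of _ "\<theta> k"]) auto
    from tendsto_cong[OF this] Y(1) show ?thesis by blast
  qed
  have "is_solution {\<theta> (k\<^sub>0 - 1)<..} g \<gamma> x"
    unfolding impulsive_solution_on_def
  proof (intro conjI ballI allI impI)
    fix t assume t: "t \<in> {\<theta> (k\<^sub>0 - 1)<..}" "t \<notin> range \<theta>"
    define k where "k = idx t"
    have k: "\<theta> (k - 1) < t" "t < \<theta> k"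
      using idx[of t] t(2) unfolding k_def by (auto simp: less_le)
    from Y(3)[OF this, of "V (nat (k - k\<^sub>0))"]
    have "(x has_vector_derivative A *v x t + (f t (x t) + g t)) (at t)"
      unfolding x[OF k(1) less_imp_le[OF k(2)], symmetric]
      by (rule has_vector_derivative_transform_within_open[of _ _ _ "{\<theta> (k - 1)<..<\<theta> k}"])
        (use k x in auto)
    then show "(x has_vector_derivative A *v x t + (f t (x t) + g t)) (at t within {\<theta> (k\<^sub>0 - 1)<..})"
      by (rule has_vector_derivative_at_within)
  next
    fix k assume "\<theta> k \<in> {\<theta> (k\<^sub>0 - 1)<..}"
    then have "k \<ge> k\<^sub>0" by (simp add: less_iff)
    have less: "\<theta> (k - 1) < \<theta> k" by (simp add: less_iff)
    then have "\<forall>\<^sub>F t in at_left (\<theta> k). x t = Y k (V (nat (k - k\<^sub>0))) t"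
      unfolding eventually_at_left_field using x by (intro exI[of _ "\<theta> (k - 1)"]) auto
    from tendsto_cong[OF this] have "(x \<longlongrightarrow> x (\<theta> k)) (at_left (\<theta> k))"
      using Y(2) x[OF less] by simp
    then show "(x \<longlongrightarrow> x (\<theta> k)) (at (\<theta> k) within {\<theta> (k\<^sub>0 - 1)<..} \<inter> {..<\<theta> k})"
      by (rule tendsto_within_subset) auto
    have "nat (k + 1 - k\<^sub>0) = Suc (nat (k - k\<^sub>0))" using \<open>k \<ge> k\<^sub>0\<close> by simp
    then have "V (nat (k + 1 - k\<^sub>0)) = x (\<theta> k) + (B *v x (\<theta> k) + (h (x (\<theta> k)) + \<gamma> k))"
      using \<open>k \<ge> k\<^sub>0\<close> x[OF less] by (simp add: V_def Let_def)
    then show "\<exists>r. (x \<longlongrightarrow> r) (at_right (\<theta> k)) \<and>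
        r - x (\<theta> k) = B *v x (\<theta> k) + (h (x (\<theta> k)) + \<gamma> k)"
      using x_right[of "k + 1"] by auto
  qed
  then show ?thesis using x_right[of k\<^sub>0] by (auto simp: V_def)
qed

end

section \<open>Bounded solutions on the line\<close>

context impulse_sequence
begin

lemma moments_at_bot: "filterlim (\<lambda>n. \<theta> (- int n - 1)) at_bot sequentially"
  unfolding filterlim_at_bot
proof
  fix Z
  obtain k where "\<theta> k < Z" using ex_below by blast
  then have "\<theta> (- int n - 1) \<le> Z" if "n \<ge> nat (- k)" for n
    using that le_iff[of "- int n - 1" k] by auto
  then show "\<forall>\<^sub>F n in sequentially. \<theta> (- int n - 1) \<le> Z"
    unfolding eventually_sequentially by blast
qed

end

lemma tendsto_norm_le:
  assumes "(x \<longlongrightarrow> r) F" "F \<noteq> bot" "\<forall>\<^sub>F t in F. norm (x t) \<le> c"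
  shows "norm r \<le> c"
  by (rule tendsto_upperbound[OF tendsto_norm[OF assms(1)]]) (use assms in auto)

context quasilinear_system
begin

lemma solution_diff:
  assumes "is_solution J g \<gamma> x" "is_solution J g' \<gamma>' y"
  shows "impulsive_solution_on J \<theta>
    (\<lambda>t v. A *v v + (f t (x t) + g t - (f t (y t) + g' t)))
    (\<lambda>k v. B *v v + (h (x (\<theta> k)) + \<gamma> k - (h (y (\<theta> k)) + \<gamma>' k))) (\<lambda>t. x t - y t)"
  using impulsive_solution_on_diff[OF assms] by simp

lemma norm_f_diff_le:
  assumes "norm (g t - g' t) \<le> \<epsilon>"
  shows "norm (f t x + g t - (f t y + g' t)) \<le> Lf * norm (x - y) + \<epsilon>"
proof -
  have "norm ((f t x - f t y) + (g t - g' t)) \<le> Lf * norm (x - y) + \<epsilon>"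
    by (rule norm_triangle_le) (intro add_mono f_lip assms)
  then show ?thesis by (simp add: algebra_simps)
qed

lemma norm_h_diff_le:
  assumes "norm (\<gamma> k - \<gamma>' k) \<le> \<epsilon>"
  shows "norm (h x + \<gamma> k - (h y + \<gamma>' k)) \<le> Lh * norm (x - y) + \<epsilon>"
proof -
  have "norm ((h x - h y) + (\<gamma> k - \<gamma>' k)) \<le> Lh * norm (x - y) + \<epsilon>"
    by (rule norm_triangle_le) (intro add_mono h_lip assms)
  then show ?thesis by (simp add: algebra_simps)
qed

lemma solution_comparison:
  obtains K \<eta> where "K > 0" "\<eta> > 0"
    "\<And>t\<^sub>0 T x y g g' \<gamma> \<gamma>' u \<epsilon> d\<^sub>0. \<lbrakk>t\<^sub>0 < T; is_solution {t\<^sub>0<..} g \<gamma> x; is_solution {t\<^sub>0<..} g' \<gamma>' y;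
       ((\<lambda>t. x t - y t) \<longlongrightarrow> d\<^sub>0) (at_right t\<^sub>0); norm d\<^sub>0 \<le> u; u > 0; \<epsilon> \<ge> 0;
       \<And>t. t\<^sub>0 < t \<Longrightarrow> t \<le> T \<Longrightarrow> norm (g t - g' t) \<le> \<epsilon>;
       \<And>k. t\<^sub>0 < \<theta> k \<Longrightarrow> \<theta> k \<le> T \<Longrightarrow> norm (\<gamma> k - \<gamma>' k) \<le> \<epsilon>\<rbrakk>
       \<Longrightarrow> norm (x T - y T) \<le> K * (exp (- \<eta> * (T - t\<^sub>0)) * u + \<epsilon>)"
proof -
  obtain K \<eta> where K: "K > 0" "\<eta> > 0"
    "\<And>t\<^sub>0 T d r \<rho> u \<epsilon> d\<^sub>0. \<lbrakk>t\<^sub>0 < T;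
       impulsive_solution_on {t\<^sub>0<..} \<theta> (\<lambda>t x. A *v x + r t) (\<lambda>k x. B *v x + \<rho> k) d;
       (d \<longlongrightarrow> d\<^sub>0) (at_right t\<^sub>0); norm d\<^sub>0 \<le> u; u > 0; \<epsilon> \<ge> 0;
       \<And>t. t\<^sub>0 < t \<Longrightarrow> t \<le> T \<Longrightarrow> norm (r t) \<le> Lf * norm (d t) + \<epsilon>;
       \<And>k. t\<^sub>0 < \<theta> k \<Longrightarrow> \<theta> k \<le> T \<Longrightarrow> norm (\<rho> k) \<le> Lh * norm (d (\<theta> k)) + \<epsilon>\<rbrakk>
       \<Longrightarrow> norm (d T) \<le> K * (exp (- \<eta> * (T - t\<^sub>0)) * u + \<epsilon>)"
    by (rule comparison) blast
  show thesis
  proof (rule that[OF K(1,2)])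
    fix t\<^sub>0 T x y g g' \<gamma> \<gamma>' u \<epsilon> d\<^sub>0
    assume *: "t\<^sub>0 < T" "is_solution {t\<^sub>0<..} g \<gamma> x" "is_solution {t\<^sub>0<..} g' \<gamma>' y"
      "((\<lambda>t. x t - y t) \<longlongrightarrow> d\<^sub>0) (at_right t\<^sub>0)" "norm d\<^sub>0 \<le> u" "u > 0" "\<epsilon> \<ge> 0"
      "\<And>t. t\<^sub>0 < t \<Longrightarrow> t \<le> T \<Longrightarrow> norm (g t - g' t) \<le> \<epsilon>"
      "\<And>k. t\<^sub>0 < \<theta> k \<Longrightarrow> \<theta> k \<le> T \<Longrightarrow> norm (\<gamma> k - \<gamma>' k) \<le> \<epsilon>"
    show "norm (x T - y T) \<le> K * (exp (- \<eta> * (T - t\<^sub>0)) * u + \<epsilon>)"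
      using *(8,9) by (intro K(3)[OF *(1) solution_diff[OF *(2,3)] *(4-7)])
        (auto intro!: norm_f_diff_le norm_h_diff_le)
  qed
qed

text \<open>\<open>comparison\<close> is applied to the solution itself: as \<open>f\<close> and
  \<open>h\<close> are bounded, the whole forcing can count as error. \<open>D\<close> does not
  depend on the starting time.\<close>

lemma solution_bounded:
  assumes "bounded (range g)" "bounded (range \<gamma>)"
  obtains D where "D > 0" "\<And>t\<^sub>0 x T. is_solution {t\<^sub>0<..} g \<gamma> x \<Longrightarrow> (x \<longlongrightarrow> 0) (at_right t\<^sub>0) \<Longrightarrow>
    t\<^sub>0 < T \<Longrightarrow> norm (x T) \<le> D"
proof -
  obtain K \<eta> where K: "K > 0" "\<eta> > 0"
    "\<And>t\<^sub>0 T d r \<rho> u \<epsilon> d\<^sub>0. \<lbrakk>t\<^sub>0 < T;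
       impulsive_solution_on {t\<^sub>0<..} \<theta> (\<lambda>t x. A *v x + r t) (\<lambda>k x. B *v x + \<rho> k) d;
       (d \<longlongrightarrow> d\<^sub>0) (at_right t\<^sub>0); norm d\<^sub>0 \<le> u; u > 0; \<epsilon> \<ge> 0;
       \<And>t. t\<^sub>0 < t \<Longrightarrow> t \<le> T \<Longrightarrow> norm (r t) \<le> Lf * norm (d t) + \<epsilon>;
       \<And>k. t\<^sub>0 < \<theta> k \<Longrightarrow> \<theta> k \<le> T \<Longrightarrow> norm (\<rho> k) \<le> Lh * norm (d (\<theta> k)) + \<epsilon>\<rbrakk>
       \<Longrightarrow> norm (d T) \<le> K * (exp (- \<eta> * (T - t\<^sub>0)) * u + \<epsilon>)"
    by (rule comparison) blast
  obtain a where a: "\<And>t. norm (g t) \<le> a" using assms(1) by (auto simp: bounded_iff)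
  obtain b where b: "\<And>k. norm (\<gamma> k) \<le> b" using assms(2) by (auto simp: bounded_iff)
  define M where "M = (Mf + a) + (Mh + b)"
  have nn: "0 \<le> Mf + a" "0 \<le> Mh + b"
    using order_trans[OF norm_ge_zero f_le] order_trans[OF norm_ge_zero a]
      order_trans[OF norm_ge_zero h_le] order_trans[OF norm_ge_zero b] by auto
  have M: "norm (f t x + g t) \<le> Lf * norm z + M" "norm (h x + \<gamma> k) \<le> Lh * norm z + M"
    for t x k z
  proof -
    have "0 \<le> Lf * norm z" "0 \<le> Lh * norm z" using Lf_pos Lh_pos by auto
    moreover have "norm (f t x + g t) \<le> Mf + a" "norm (h x + \<gamma> k) \<le> Mh + b"
      by (rule norm_triangle_le, intro add_mono f_le a h_le b)+
    ultimately show "norm (f t x + g t) \<le> Lf * norm z + M" "norm (h x + \<gamma> k) \<le> Lh * norm z + M"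
      using nn unfolding M_def by linarith+
  qed
  show thesis
  proof (rule that[of "K * (1 + M)"])
    show "K * (1 + M) > 0" using K(1) nn by (simp add: M_def)
    fix t\<^sub>0 x T
    assume sol: "is_solution {t\<^sub>0<..} g \<gamma> x" and x: "(x \<longlongrightarrow> 0) (at_right t\<^sub>0)" and T: "t\<^sub>0 < T"
    have "impulsive_solution_on {t\<^sub>0<..} \<theta> (\<lambda>t v. A *v v + (f t (x t) + g t))
        (\<lambda>k v. B *v v + (h (x (\<theta> k)) + \<gamma> k)) x"
      using sol by (simp add: impulsive_solution_on_def)
    from T this x have "norm (x T) \<le> K * (exp (- \<eta> * (T - t\<^sub>0)) * 1 + M)"
      by (rule K(3)) (use nn in \<open>simp_all add: M, simp add: M_def\<close>)
    also have "\<dots> \<le> K * (1 + M)" using K T by (intro mult_left_mono) auto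
    finally show "norm (x T) \<le> K * (1 + M)" .
  qed
qed

text \<open>The solutions that start with value \<open>0\<close> at \<open>\<theta> (- n - 1)\<close> form a Cauchy sequence, since
  solutions approach each other exponentially.\<close>

lemma bounded_solution_exists:
  assumes g: "g \<in> BPC \<theta>" and \<gamma>: "bounded (range \<gamma>)"
  obtains x where "is_solution UNIV g \<gamma> x" "bounded (range x)"
proof -
  obtain K \<eta> where K: "K > 0" "\<eta> > 0" and comp:
    "\<And>t\<^sub>0 T x y g g' \<gamma> \<gamma>' u \<epsilon> d\<^sub>0. \<lbrakk>t\<^sub>0 < T; is_solution {t\<^sub>0<..} g \<gamma> x; is_solution {t\<^sub>0<..} g' \<gamma>' y;
       ((\<lambda>t. x t - y t) \<longlongrightarrow> d\<^sub>0) (at_right t\<^sub>0); norm d\<^sub>0 \<le> u; u > 0; \<epsilon> \<ge> 0;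
       \<And>t. t\<^sub>0 < t \<Longrightarrow> t \<le> T \<Longrightarrow> norm (g t - g' t) \<le> \<epsilon>;
       \<And>k. t\<^sub>0 < \<theta> k \<Longrightarrow> \<theta> k \<le> T \<Longrightarrow> norm (\<gamma> k - \<gamma>' k) \<le> \<epsilon>\<rbrakk>
       \<Longrightarrow> norm (x T - y T) \<le> K * (exp (- \<eta> * (T - t\<^sub>0)) * u + \<epsilon>)"
    by (rule solution_comparison) blast
  have contract: "norm (x T - y T) \<le> K * (exp (- \<eta> * (T - t\<^sub>0)) * u)"
    if "t\<^sub>0 < T" "is_solution {t\<^sub>0<..} g \<gamma> x" "is_solution {t\<^sub>0<..} g \<gamma> y"
      "(x \<longlongrightarrow> v) (at_right t\<^sub>0)" "(y \<longlongrightarrow> w) (at_right t\<^sub>0)" "norm (v - w) \<le> u" "u > 0"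
    for t\<^sub>0 T x y v w u
    using comp[OF that(1,2,3) tendsto_diff[OF that(4,5)] that(6,7), of 0] by simp
  have bdd: "bounded (range g)" using g by (simp add: BPC_def)
  obtain D where D: "D > 0" "\<And>t\<^sub>0 x T. is_solution {t\<^sub>0<..} g \<gamma> x \<Longrightarrow> (x \<longlongrightarrow> 0) (at_right t\<^sub>0) \<Longrightarrow>
    t\<^sub>0 < T \<Longrightarrow> norm (x T) \<le> D"
    by (rule solution_bounded[OF bdd \<gamma>]) blast
  define X where "X k v = (SOME x. is_solution {\<theta> (k - 1)<..} g \<gamma> x \<and>
    (x \<longlongrightarrow> v) (at_right (\<theta> (k - 1))))" for k v
  have X: "is_solution {\<theta> (k - 1)<..} g \<gamma> (X k v)" "(X k v \<longlongrightarrow> v) (at_right (\<theta> (k - 1)))" for k v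
    using someI_ex[OF solution_exists[OF g]] unfolding X_def by blast+
  define z where "z n = X (- int n) 0" for n
  define s where "s n = \<theta> (- int n - 1)" for n
  have z: "is_solution {s n<..} g \<gamma> (z n)" "(z n \<longlongrightarrow> 0) (at_right (s n))" for n
    using X[of "- int n"] by (simp_all add: z_def s_def)
  have z_le: "norm (z n T) \<le> D" if "s n < T" for n T
    using D(2)[OF z that] .
  \<comment> \<open>A solution that started at or before \<open>s n\<close> has there a right limit
    of norm at most \<open>D\<close>; this is its initial value when it is compared with
    \<open>z n\<close>.\<close>
  have z_right: "\<exists>r. (z m \<longlongrightarrow> r) (at_right t) \<and> norm r \<le> D" if "s m \<le> t" for m t
  proof (cases "s m = t")
    case True
    then show ?thesis using z(2)[of m] D(1) by (intro exI[of _ 0]) auto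
  next
    case False
    with that have less: "s m < t" by simp
    then obtain r where r: "(z m \<longlongrightarrow> r) (at_right t)"
      using impulsive_solution_on_right[OF z(1)[of m], of t] by auto
    moreover have "\<forall>\<^sub>F u in at_right t. norm (z m u) \<le> D"
      using less by (auto simp: eventually_at_filter intro!: z_le always_eventually)
    then have "norm r \<le> D" by (rule tendsto_norm_le[OF r trivial_limit_at_right_real])
    ultimately show ?thesis by blast
  qed
  have z_cauchy: "norm (z m T - z n T) \<le> K * D * exp (- \<eta> * (T - s n))"
    if "n \<le> m" "s n < T" for m n T
  proof -
    have "s m \<le> s n" using that by (simp add: s_def le_iff)
    then obtain r where r: "(z m \<longlongrightarrow> r) (at_right (s n))" "norm r \<le> D" using z_right by blast
    have "is_solution {s n<..} g \<gamma> (z m)"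
      by (rule impulsive_solution_on_subset[OF z(1)]) (use \<open>s m \<le> s n\<close> in auto)
    from contract[OF that(2) this z(1) r(1) z(2), of D]
    show ?thesis using r D(1) by (simp add: mult_ac)
  qed
  have s_small: "\<exists>M. \<forall>n\<ge>M. s n < t \<and> K * D * exp (- \<eta> * (t - s n)) < e" if "e > 0" for t e
  proof -
    have "K * D > 0" using K D by simp
    from exp_decay[OF this K(2) that]
    obtain \<tau>\<^sub>0 where \<tau>: "\<And>\<tau>. \<tau> \<ge> \<tau>\<^sub>0 \<Longrightarrow> K * D * exp (- \<eta> * \<tau>) < e" by blast
    have "\<forall>\<^sub>F n in sequentially. s n \<le> min (t - \<tau>\<^sub>0) (t - 1)"
      using moments_at_bot unfolding filterlim_at_bot s_def by blast
    then obtain M where M: "\<And>n. n \<ge> M \<Longrightarrow> s n \<le> min (t - \<tau>\<^sub>0) (t - 1)"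
      unfolding eventually_sequentially by blast
    show ?thesis
    proof (intro exI[of _ M] allI impI conjI)
      fix n assume "n \<ge> M"
      from M[OF this] show "s n < t" "K * D * exp (- \<eta> * (t - s n)) < e"
        using \<tau>[of "t - s n"] by auto
    qed
  qed
  have "Cauchy (\<lambda>n. z n T)" for T
  proof (rule CauchyI')
    fix e :: real assume "e > 0"
    then obtain M where M: "\<And>n. n \<ge> M \<Longrightarrow> s n < T \<and> K * D * exp (- \<eta> * (T - s n)) < e"
      using s_small by blast
    have "dist (z m T) (z n T) < e" if "M \<le> m" "m < n" for m n
      using z_cauchy[of m n T] M[of m] that by (simp add: dist_norm norm_minus_commute)
    then show "\<exists>M. \<forall>m\<ge>M. \<forall>n>m. dist (z m T) (z n T) < e" by blast
  qed
  then have "convergent (\<lambda>n. z n T)" for T by (rule Cauchy_convergent)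
  define x where "x T = lim (\<lambda>n. z n T)" for T
  have x: "(\<lambda>n. z n T) \<longlonglongrightarrow> x T" for T
    unfolding x_def convergent_LIMSEQ_iff[symmetric] by fact
  have ev_s: "\<forall>\<^sub>F n in sequentially. s n < t" for t
    using s_small[of 1 t] by (auto simp: eventually_sequentially)
  have "norm (x T) \<le> D" for T
    by (rule tendsto_norm_le[OF x sequentially_bot]) (use ev_s[of T] z_le in \<open>auto elim: eventually_mono\<close>)
  then have "bounded (range x)" by (auto simp: bounded_iff)
  \<comment> \<open>No limit is taken inside the equations. Beyond each moment, \<open>x\<close> is
    identified with the solution \<open>y\<close> that starts from the limit of the right limits of
    the \<open>z n\<close>; by continuous dependence \<open>z n\<close> tends to
    \<open>y\<close>.\<close>
  moreover have "is_solution {\<theta> k<..} g \<gamma> x" for k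
  proof -
    let ?t = "\<theta> k"
    obtain M\<^sub>0 where M\<^sub>0: "\<And>n. n \<ge> M\<^sub>0 \<Longrightarrow> s n < ?t" using ev_s[of ?t] by (auto simp: eventually_sequentially)
    have "\<forall>n. \<exists>r. n \<ge> M\<^sub>0 \<longrightarrow> (z n \<longlongrightarrow> r) (at_right ?t)"
      using z_right M\<^sub>0 by (meson less_imp_le)
    then obtain r where r: "\<And>n. n \<ge> M\<^sub>0 \<Longrightarrow> (z n \<longlongrightarrow> r n) (at_right ?t)" by metis
    have r_cauchy: "norm (r m - r n) \<le> K * D * exp (- \<eta> * (?t - s n))" if "M\<^sub>0 \<le> n" "n \<le> m" for m n
    proof (rule tendsto_norm_le[OF tendsto_diff[OF r r] trivial_limit_at_right_real])
      \<comment> \<open>The bound decreases in \<open>u\<close>, so its value at \<open>?t\<close>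
        holds everywhere to the right and passes to the right limits.\<close>
      have "norm (z m u - z n u) \<le> K * D * exp (- \<eta> * (?t - s n))" if u: "?t < u" for u
      proof -
        have "norm (z m u - z n u) \<le> K * D * exp (- \<eta> * (u - s n))"
          using M\<^sub>0[of n] \<open>M\<^sub>0 \<le> n\<close> \<open>n \<le> m\<close> u by (intro z_cauchy) auto
        also have "\<dots> \<le> K * D * exp (- \<eta> * (?t - s n))"
          using u K D by (intro mult_left_mono) auto
        finally show ?thesis .
      qed
      then show "\<forall>\<^sub>F u in at_right ?t. norm (z m u - z n u) \<le> K * D * exp (- \<eta> * (?t - s n))"
        by (auto simp: eventually_at_filter intro!: always_eventually)
    qed (use that in auto)
    have "Cauchy r"
    proof (rule CauchyI')
      fix e :: real assume "e > 0"
      then obtain M where M: "\<And>n. n \<ge> M \<Longrightarrow> s n < ?t \<and> K * D * exp (- \<eta> * (?t - s n)) < e"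
        using s_small by blast
      have "dist (r m) (r n) < e" if "max M M\<^sub>0 \<le> m" "m < n" for m n
        using r_cauchy[of m n] M[of m] that by (simp add: dist_norm norm_minus_commute)
      then show "\<exists>M. \<forall>m\<ge>M. \<forall>n>m. dist (r m) (r n) < e" by blast
    qed
    then obtain v where v: "r \<longlonglongrightarrow> v" using Cauchy_convergent convergent_def by blast
    define y where "y = X (k + 1) v"
    have y: "is_solution {?t<..} g \<gamma> y" "(y \<longlongrightarrow> v) (at_right ?t)"
      using X[of "k + 1" v] by (auto simp: y_def)
    have "x T = y T" if T: "?t < T" for T
    proof (rule LIMSEQ_unique[OF x])
      show "(\<lambda>n. z n T) \<longlonglongrightarrow> y T"
      proof (rule LIMSEQ_I)
        fix e :: real assume "e > 0"
        define u where "u = e / (2 * K)"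
        have "u > 0" using \<open>e > 0\<close> K by (simp add: u_def)
        then obtain M where M: "\<And>n. n \<ge> M \<Longrightarrow> norm (r n - v) < u" using LIMSEQ_D[OF v] by blast
        have "norm (z n T - y T) < e" if "n \<ge> max M M\<^sub>0" for n
        proof -
          have n: "M \<le> n" "M\<^sub>0 \<le> n" using that by auto
          have "is_solution {?t<..} g \<gamma> (z n)"
            by (rule impulsive_solution_on_subset[OF z(1)[of n]]) (use M\<^sub>0[OF n(2)] in auto)
          from contract[OF T this y(1) r[OF n(2)] y(2) less_imp_le[OF M[OF n(1)]] \<open>u > 0\<close>]
          have "norm (z n T - y T) \<le> K * (exp (- \<eta> * (T - ?t)) * u)" .
          also have "\<dots> \<le> K * (1 * u)"
            using K T \<open>u > 0\<close> by (intro mult_left_mono mult_right_mono) auto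
          also have "\<dots> < e" using K \<open>e > 0\<close> by (simp add: u_def)
          finally show ?thesis .
        qed
        then show "\<exists>no. \<forall>n\<ge>no. norm (z n T - y T) < e" by blast
      qed
    qed
    then show ?thesis by (intro impulsive_solution_on_cong[OF y(1)]) auto
  qed
  then have "is_solution UNIV g \<gamma> x" by (rule impulsive_solution_on_UNIV_I)
  ultimately show thesis using that by blast
qed

end

lemma filterlim_at_right_shift:
  fixes a c :: real shows "filterlim (\<lambda>t. t + c) (at_right (a + c)) (at_right a)"
  unfolding filterlim_at by (auto simp: eventually_at_filter intro!: tendsto_intros)

lemma filterlim_at_left_shift:
  fixes a c :: real shows "filterlim (\<lambda>t. t + c) (at_left (a + c)) (at_left a)"
  unfolding filterlim_at by (auto simp: eventually_at_filter intro!: tendsto_intros)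

lemma bounded_diff:
  fixes x y :: "'a \<Rightarrow> 'b::real_normed_vector"
  assumes "bounded (range x)" "bounded (range y)"
  obtains D where "D > 0" "\<And>s t. norm (x s - y t) \<le> D"
proof -
  obtain a b where "\<And>t. norm (x t) \<le> a" "\<And>t. norm (y t) \<le> b"
    using assms by (auto simp: bounded_iff)
  then have ab: "norm (x s - y t) \<le> a + b" for s t by (meson add_mono norm_triangle_ineq4 order_trans)
  show thesis
  proof (rule that[of "max 1 (a + b)"])
    show "norm (x s - y t) \<le> max 1 (a + b)" for s t using ab[of s t] by simp
  qed simp
qed

section \<open>Blocks of \<open>p\<close> segments and piecewise constant inputs\<close>

context impulse_sequence
begin

text \<open>Block \<open>j\<close> consists of the segments \<open>j * p + 1\<close> to
  \<open>(j + 1) * p\<close>, hence the subtraction of one before the division. On it the given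
  input \<open>g1\<close> takes the value \<open>\<sigma> j\<close>.\<close>

definition block :: "real \<Rightarrow> int" where
  "block t = (idx t - 1) div int p"

lemma block_eqI:
  assumes "\<theta> (k - 1) < t" "t \<le> \<theta> k"
  shows "block t = (k - 1) div int p"
  by (simp add: block_def idx_eqI[OF assms])

lemma block: "\<theta> (block t * int p) < t" "t \<le> \<theta> ((block t + 1) * int p)"
proof -
  let ?k = "idx t"
  have "block t * int p + (?k - 1) mod int p = ?k - 1" by (simp add: block_def)
  moreover have "0 \<le> (?k - 1) mod int p" "(?k - 1) mod int p < int p" using p_pos by auto
  ultimately have "\<theta> (block t * int p) \<le> \<theta> (?k - 1)" "\<theta> ?k \<le> \<theta> ((block t + 1) * int p)"
    by (auto simp: le_iff distrib_right)
  then show "\<theta> (block t * int p) < t" "t \<le> \<theta> ((block t + 1) * int p)"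
    using idx[of t] by auto
qed

lemma block_mono: "s \<le> t \<Longrightarrow> block s \<le> block t"
proof -
  assume "s \<le> t"
  then have "\<theta> (block s * int p) < \<theta> ((block t + 1) * int p)" using block[of s] block[of t] by linarith
  then show "block s \<le> block t" using p_pos by (simp add: less_iff)
qed

lemma block_shift: "block (t + of_int j * \<omega>) = block t + j"
proof -
  have "idx (t + of_int j * \<omega>) = idx t + j * int p"
    by (rule idx_eqI)
      (use idx[of t] shift[of "idx t - 1" j] shift[of "idx t" j] in \<open>auto simp: algebra_simps\<close>)
  then show ?thesis
    using p_pos div_mult_self1[of "int p" "idx t - 1" j]
    by (simp add: block_def algebra_simps)
qed

lemma block_at_top: "filterlim block at_top at_top"
  unfolding filterlim_at_top
proof
  fix Z
  have "Z \<le> block t" if "t \<ge> \<theta> (Z * int p) + 1" for t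
  proof -
    have "\<theta> (Z * int p) < \<theta> ((block t + 1) * int p)" using that block[of t] by linarith
    then show ?thesis using p_pos by (simp add: less_iff)
  qed
  then show "\<forall>\<^sub>F t in at_top. Z \<le> block t" by (rule eventually_at_top_linorderI)
qed

lemma segment_BPC:
  assumes "bounded (range c)" and \<phi>: "\<And>k t. \<theta> (k - 1) < t \<Longrightarrow> t \<le> \<theta> k \<Longrightarrow> \<phi> t = c k"
  shows "\<phi> \<in> BPC \<theta>"
  unfolding BPC_def
proof (intro CollectI conjI allI)
  have "\<phi> t = c (idx t)" for t using \<phi> idx by blast
  then show "bounded (range \<phi>)" using assms(1) by (auto intro: bounded_subset)
  fix k
  have less: "\<theta> (k - 1) < \<theta> k" "\<theta> k < \<theta> (k + 1)" by (simp_all add: less_iff)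
  show "continuous_on {\<theta> (k - 1)<..<\<theta> k} \<phi>"
    by (rule continuous_on_eq[OF continuous_on_const[of _ "c k"]]) (simp add: \<phi>[of k])
  have "\<forall>\<^sub>F t in at_right (\<theta> k). \<phi> t = c (k + 1)"
    unfolding eventually_at_right_field using less \<phi>[of "k + 1"] by (intro exI[of _ "\<theta> (k + 1)"]) auto
  from tendsto_eventually[OF this] show "\<exists>r. (\<phi> \<longlongrightarrow> r) (at_right (\<theta> k))" by blast
  have "\<forall>\<^sub>F t in at_left (\<theta> k). \<phi> t = \<phi> (\<theta> k)"
    unfolding eventually_at_left_field using less \<phi>[of k] by (intro exI[of _ "\<theta> (k - 1)"]) auto
  then show "(\<phi> \<longlongrightarrow> \<phi> (\<theta> k)) (at_left (\<theta> k))" by (rule tendsto_eventually)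
qed

lemma block_BPC: "bounded (range \<alpha>) \<Longrightarrow> (\<lambda>t. \<alpha> (block t)) \<in> BPC \<theta>"
  by (rule segment_BPC[of "\<lambda>k. \<alpha> ((k - 1) div int p)"])
    (auto simp: block_eqI intro: bounded_subset)

lemma BPC_diff:
  assumes "\<phi> \<in> BPC \<theta>" "\<psi> \<in> BPC \<theta>"
  shows "(\<lambda>t. \<phi> t - \<psi> t) \<in> BPC \<theta>"
  unfolding BPC_def
proof (intro CollectI conjI allI)
  fix k
  obtain r r' where "(\<phi> \<longlongrightarrow> r) (at_right (\<theta> k))" "(\<psi> \<longlongrightarrow> r') (at_right (\<theta> k))"
    using assms unfolding BPC_def by blast
  then show "\<exists>r. ((\<lambda>t. \<phi> t - \<psi> t) \<longlongrightarrow> r) (at_right (\<theta> k))" by (blast intro: tendsto_diff)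
qed (use assms in \<open>auto simp: BPC_def intro!: bounded_minus_comp continuous_intros tendsto_diff\<close>)

lemma BPC_add:
  assumes "\<phi> \<in> BPC \<theta>" "\<psi> \<in> BPC \<theta>"
  shows "(\<lambda>t. \<phi> t + \<psi> t) \<in> BPC \<theta>"
  unfolding BPC_def
proof (intro CollectI conjI allI)
  fix k
  obtain r r' where "(\<phi> \<longlongrightarrow> r) (at_right (\<theta> k))" "(\<psi> \<longlongrightarrow> r') (at_right (\<theta> k))"
    using assms unfolding BPC_def by blast
  then show "\<exists>r. ((\<lambda>t. \<phi> t + \<psi> t) \<longlongrightarrow> r) (at_right (\<theta> k))" by (blast intro: tendsto_add)
qed (use assms in \<open>auto simp: BPC_def intro!: bounded_plus_comp continuous_intros tendsto_add\<close>)

end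

section \<open>Shifts of bounded solutions and their dependence on the inputs\<close>

context quasilinear_system
begin

lemma solution_BPC:
  assumes sol: "is_solution UNIV g \<gamma> x" and "bounded (range x)"
  shows "x \<in> BPC \<theta>"
  unfolding BPC_def
proof (intro CollectI conjI allI)
  fix k
  show "continuous_on {\<theta> (k - 1)<..<\<theta> k} x"
    using impulsive_solution_on_deriv[OF sol] not_moment[of k]
    by (intro continuous_at_imp_continuous_on ballI)
      (auto intro!: has_vector_derivative_continuous)
qed (use assms impulsive_solution_on_left[OF sol] impulsive_solution_on_right[OF sol] in auto)

text \<open>\<open>f\<close> and \<theta> share the period \<omega>, so only the inputs notice the
  shift. Closeness of shifted inputs thereby becomes closeness of a solution to its own
  shift.\<close>

lemma solution_shift:
  assumes sol: "is_solution UNIV g \<gamma> x"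
  shows "is_solution UNIV (\<lambda>t. g (t + of_int j * \<omega>)) (\<lambda>k. \<gamma> (k + j * int p)) (\<lambda>t. x (t + of_int j * \<omega>))"
  unfolding impulsive_solution_on_def
proof (intro conjI ballI allI impI)
  let ?c = "of_int j * \<omega>"
  fix t assume t: "t \<notin> range \<theta>"
  have "t + ?c \<notin> range \<theta>"
  proof
    assume "t + ?c \<in> range \<theta>"
    then obtain k where "t + ?c = \<theta> k" by auto
    then have "t = \<theta> (k + (- j) * int p)" unfolding shift by simp
    with t show False by simp
  qed
  then have 1: "(x has_vector_derivative A *v x (t + ?c) + (f (t + ?c) (x (t + ?c)) + g (t + ?c))) (at (t + ?c))"
    using impulsive_solution_on_deriv[OF sol] by auto
  have "((\<lambda>t. t + ?c) has_vector_derivative 1) (at t)" by (auto intro!: derivative_eq_intros)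
  from vector_diff_chain_at[OF this 1]
  show "((\<lambda>t. x (t + ?c)) has_vector_derivative
      A *v x (t + ?c) + (f t (x (t + ?c)) + g (t + ?c))) (at t)"
    by (simp add: o_def f_shift)
next
  let ?c = "of_int j * \<omega>"
  fix k
  have \<theta>k: "\<theta> (k + j * int p) = \<theta> k + ?c" by (rule shift)
  show "((\<lambda>t. x (t + ?c)) \<longlongrightarrow> x (\<theta> k + ?c)) (at (\<theta> k) within UNIV \<inter> {..<\<theta> k})"
    using filterlim_compose[OF impulsive_solution_on_left[OF sol] filterlim_at_left_shift] by simp
  obtain r where r: "(x \<longlongrightarrow> r) (at_right (\<theta> k + ?c))" "r - x (\<theta> k + ?c)
      = B *v x (\<theta> k + ?c) + (h (x (\<theta> k + ?c)) + \<gamma> (k + j * int p))"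
    using sol unfolding impulsive_solution_on_def \<theta>k[symmetric] by blast
  then show "\<exists>r. ((\<lambda>t. x (t + ?c)) \<longlongrightarrow> r) (at_right (\<theta> k)) \<and> r - x (\<theta> k + ?c)
      = B *v x (\<theta> k + ?c) + (h (x (\<theta> k + ?c)) + \<gamma> (k + j * int p))"
    using filterlim_compose[OF r(1) filterlim_at_right_shift] by blast
qed

text \<open>After the waiting time \<tau> an initial difference of size \<open>D\<close> contributes
  less than \<open>e / 2\<close>; inputs that differ by at most \<open>e / (2 * K)\<close>
  contribute at most the other half.\<close>

lemma bounded_solution_comparison:
  assumes "e > 0" "D > 0"
  obtains \<tau> \<epsilon> where "\<tau> > 0" "\<epsilon> > 0"
    "\<And>t\<^sub>0 T x y g g' \<gamma> \<gamma>'. \<lbrakk>t\<^sub>0 + \<tau> \<le> T; is_solution UNIV g \<gamma> x; is_solution UNIV g' \<gamma>' y;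
       \<And>t. norm (x t - y t) \<le> D;
       \<And>t. t\<^sub>0 < t \<Longrightarrow> t \<le> T \<Longrightarrow> norm (g t - g' t) \<le> \<epsilon>;
       \<And>k. t\<^sub>0 < \<theta> k \<Longrightarrow> \<theta> k \<le> T \<Longrightarrow> norm (\<gamma> k - \<gamma>' k) \<le> \<epsilon>\<rbrakk>
       \<Longrightarrow> norm (x T - y T) < e"
proof -
  obtain K \<eta> where K: "K > 0" "\<eta> > 0" and comp:
    "\<And>t\<^sub>0 T x y g g' \<gamma> \<gamma>' u \<epsilon> d\<^sub>0. \<lbrakk>t\<^sub>0 < T; is_solution {t\<^sub>0<..} g \<gamma> x; is_solution {t\<^sub>0<..} g' \<gamma>' y;
       ((\<lambda>t. x t - y t) \<longlongrightarrow> d\<^sub>0) (at_right t\<^sub>0); norm d\<^sub>0 \<le> u; u > 0; \<epsilon> \<ge> 0;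
       \<And>t. t\<^sub>0 < t \<Longrightarrow> t \<le> T \<Longrightarrow> norm (g t - g' t) \<le> \<epsilon>;
       \<And>k. t\<^sub>0 < \<theta> k \<Longrightarrow> \<theta> k \<le> T \<Longrightarrow> norm (\<gamma> k - \<gamma>' k) \<le> \<epsilon>\<rbrakk>
       \<Longrightarrow> norm (x T - y T) \<le> K * (exp (- \<eta> * (T - t\<^sub>0)) * u + \<epsilon>)"
    by (rule solution_comparison) blast
  have "K * D > 0" "e / 2 > 0" using K assms by auto
  from exp_decay[OF this(1) K(2) this(2)]
  obtain \<tau>\<^sub>0 where \<tau>: "\<And>\<tau>. \<tau> \<ge> \<tau>\<^sub>0 \<Longrightarrow> K * D * exp (- \<eta> * \<tau>) < e / 2" by blast
  show thesis
  proof (rule that[of "max 1 \<tau>\<^sub>0" "e / (2 * K)"])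
    show "max 1 \<tau>\<^sub>0 > 0" "e / (2 * K) > 0" using K assms by auto
    fix t\<^sub>0 T x y g g' \<gamma> \<gamma>'
    assume *: "t\<^sub>0 + max 1 \<tau>\<^sub>0 \<le> T" "is_solution UNIV g \<gamma> x" "is_solution UNIV g' \<gamma>' y"
      "\<And>t. norm (x t - y t) \<le> D"
      "\<And>t. t\<^sub>0 < t \<Longrightarrow> t \<le> T \<Longrightarrow> norm (g t - g' t) \<le> e / (2 * K)"
      "\<And>k. t\<^sub>0 < \<theta> k \<Longrightarrow> \<theta> k \<le> T \<Longrightarrow> norm (\<gamma> k - \<gamma>' k) \<le> e / (2 * K)"
    obtain d where d: "((\<lambda>t. x t - y t) \<longlongrightarrow> d) (at_right t\<^sub>0)"
      using impulsive_solution_on_right[OF solution_diff[OF *(2,3)]] by auto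
    have "norm d \<le> D" by (rule tendsto_norm_le[OF d]) (use *(4) in auto)
    have "norm (x T - y T) \<le> K * (exp (- \<eta> * (T - t\<^sub>0)) * D + e / (2 * K))"
      by (rule comp[of t\<^sub>0 T g \<gamma> x g' \<gamma>' y, OF _ _ _ d \<open>norm d \<le> D\<close> assms(2)])
        (use * K assms in \<open>auto intro: impulsive_solution_on_subset\<close>)
    also have "\<dots> = K * D * exp (- \<eta> * (T - t\<^sub>0)) + e / 2"
      using K by (simp add: distrib_left mult_ac)
    also have "\<dots> < e" using \<tau>[of "T - t\<^sub>0"] *(1) by linarith
    finally show "norm (x T - y T) < e" .
  qed
qed

text \<open>With equal inputs nothing remains but the forgotten initial difference. Starting the
  comparison early enough before \<open>T\<close> makes the difference at \<open>T\<close> smaller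
  than itself.\<close>

lemma bounded_solution_unique:
  assumes x: "is_solution UNIV g \<gamma> x" "bounded (range x)"
    and y: "is_solution UNIV g \<gamma> y" "bounded (range y)"
  shows "x = y"
proof (rule ext, rule ccontr)
  fix T assume "x T \<noteq> y T"
  define e where "e = norm (x T - y T)"
  have pos: "e > 0" using \<open>x T \<noteq> y T\<close> by (simp add: e_def)
  obtain D where D: "D > 0" "\<And>s t. norm (x s - y t) \<le> D" using bounded_diff[OF x(2) y(2)] by blast
  obtain \<tau> \<epsilon> where \<tau>: "\<tau> > 0" "\<epsilon> > 0" and comp:
    "\<And>t\<^sub>0 T' x y g g' \<gamma> \<gamma>'. \<lbrakk>t\<^sub>0 + \<tau> \<le> T'; is_solution UNIV g \<gamma> x; is_solution UNIV g' \<gamma>' y;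
       \<And>t. norm (x t - y t) \<le> D;
       \<And>t. t\<^sub>0 < t \<Longrightarrow> t \<le> T' \<Longrightarrow> norm (g t - g' t) \<le> \<epsilon>;
       \<And>k. t\<^sub>0 < \<theta> k \<Longrightarrow> \<theta> k \<le> T' \<Longrightarrow> norm (\<gamma> k - \<gamma>' k) \<le> \<epsilon>\<rbrakk>
       \<Longrightarrow> norm (x T' - y T') < e"
    by (rule bounded_solution_comparison[OF pos D(1)]) blast
  have "norm (x T - y T) < e"
    by (rule comp[of "T - \<tau>" T g \<gamma> x g \<gamma> y]) (use x y D \<tau> in auto)
  then show False by (simp add: e_def)
qed

lemma bounded_solution_diff_tendsto_0:
  assumes x: "is_solution UNIV g \<gamma> x" "bounded (range x)"
    and y: "is_solution UNIV g' \<gamma>' y" "bounded (range y)"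
    and g: "((\<lambda>t. norm (g t - g' t)) \<longlongrightarrow> 0) at_top"
    and \<gamma>: "((\<lambda>k. norm (\<gamma> k - \<gamma>' k)) \<longlongrightarrow> 0) at_top"
  shows "((\<lambda>t. norm (x t - y t)) \<longlongrightarrow> 0) at_top"
proof (rule tendstoI)
  fix e :: real assume "e > 0"
  obtain D where D: "D > 0" "\<And>s t. norm (x s - y t) \<le> D" using bounded_diff[OF x(2) y(2)] by blast
  obtain \<tau> \<epsilon> where \<tau>: "\<tau> > 0" "\<epsilon> > 0" and comp:
    "\<And>t\<^sub>0 T x y g g' \<gamma> \<gamma>'. \<lbrakk>t\<^sub>0 + \<tau> \<le> T; is_solution UNIV g \<gamma> x; is_solution UNIV g' \<gamma>' y;
       \<And>t. norm (x t - y t) \<le> D;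
       \<And>t. t\<^sub>0 < t \<Longrightarrow> t \<le> T \<Longrightarrow> norm (g t - g' t) \<le> \<epsilon>;
       \<And>k. t\<^sub>0 < \<theta> k \<Longrightarrow> \<theta> k \<le> T \<Longrightarrow> norm (\<gamma> k - \<gamma>' k) \<le> \<epsilon>\<rbrakk>
       \<Longrightarrow> norm (x T - y T) < e"
    by (rule bounded_solution_comparison[OF \<open>e > 0\<close> D(1)]) blast
  obtain t\<^sub>1 where t\<^sub>1: "\<And>t. t \<ge> t\<^sub>1 \<Longrightarrow> norm (g t - g' t) \<le> \<epsilon>"
    using order_tendstoD(2)[OF g \<tau>(2)] unfolding eventually_at_top_linorder by (meson less_imp_le)
  obtain k\<^sub>1 where k\<^sub>1: "\<And>k. k \<ge> k\<^sub>1 \<Longrightarrow> norm (\<gamma> k - \<gamma>' k) \<le> \<epsilon>"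
    using order_tendstoD(2)[OF \<gamma> \<tau>(2)] unfolding eventually_at_top_linorder by (meson less_imp_le)
  define t\<^sub>0 where "t\<^sub>0 = max t\<^sub>1 (\<theta> k\<^sub>1)"
  have "dist (norm (x T - y T)) 0 < e" if "T \<ge> t\<^sub>0 + \<tau>" for T
  proof -
    have "norm (x T - y T) < e"
      by (rule comp[OF that x(1) y(1) D(2)]) (auto simp: t\<^sub>0_def less_iff intro!: t\<^sub>1 k\<^sub>1)
    then show ?thesis by simp
  qed
  then show "\<forall>\<^sub>F T in at_top. dist (norm (x T - y T)) 0 < e" by (rule eventually_at_top_linorderI)
qed

text \<open>All terms of the equation are bounded, hence so is the derivative. One constant serves
  all segments, as the uniform continuity in the definition of unpredictability demands.\<close>

lemma solution_lipschitz:
  assumes sol: "is_solution UNIV g \<gamma> x" "bounded (range x)" "bounded (range g)"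
  obtains M where "M > 0" "\<And>k s t. \<theta> (k - 1) < s \<Longrightarrow> s \<le> \<theta> k \<Longrightarrow> \<theta> (k - 1) < t \<Longrightarrow> t \<le> \<theta> k \<Longrightarrow>
    norm (x s - x t) \<le> M * \<bar>s - t\<bar>"
proof -
  obtain C where C: "\<And>t. norm (x t) \<le> C" using sol(2) by (auto simp: bounded_iff)
  obtain a where a: "\<And>t. norm (g t) \<le> a" using sol(3) by (auto simp: bounded_iff)
  have A: "0 \<le> spectral_norm A" unfolding spectral_norm_def by (rule onorm_pos_le) simp
  define M where "M = spectral_norm A * C + (Mf + a) + 1"
  have M: "norm (A *v x t + (f t (x t) + g t)) \<le> M" for t
  proof -
    have "norm (A *v x t + (f t (x t) + g t)) \<le> spectral_norm A * C + (Mf + a)"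
      by (intro norm_triangle_le add_mono f_le a
          order_trans[OF norm_matrix_vector_mult_le mult_left_mono[OF C A]])
    then show ?thesis by (simp add: M_def)
  qed
  have *: "norm (x t - x s) \<le> M * t - M * s"
    if "\<theta> (k - 1) < s" "t \<le> \<theta> k" "s < t" for k s t
  proof (rule differentiable_bound_general[OF \<open>s < t\<close>])
    have nm: "u \<notin> range \<theta>" if "s \<le> u" "u < t" for u
      using that \<open>\<theta> (k - 1) < s\<close> \<open>t \<le> \<theta> k\<close> by (intro not_moment[of k]) auto
    then have cont: "isCont x u" if "s \<le> u" "u < t" for u
      using that impulsive_solution_on_deriv[OF sol(1)]
      by (auto intro!: has_vector_derivative_continuous)
    have "continuous_on {s..t} (x(s := x s))"
      using impulsive_solution_on_left[OF sol(1)] cont[of s] cont \<open>s < t\<close>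
      by (intro continuous_on_upd_right_limit)
        (auto simp: continuous_within intro: tendsto_within_subset)
    then show "continuous_on {s..t} x" by simp
    show "continuous_on {s..t} ((*) M)" by (intro continuous_intros)
    fix u assume u: "s < u" "u < t"
    show "(x has_vector_derivative A *v x u + (f u (x u) + g u)) (at u)"
      using impulsive_solution_on_deriv[OF sol(1)] nm u by auto
    show "((*) M has_vector_derivative M) (at u)" by (auto intro!: derivative_eq_intros)
  qed (rule M)
  show thesis
  proof (rule that[of M])
    show "M > 0"
      using A C[of 0] norm_ge_zero[of "x 0"] f_le[of 0 0] norm_ge_zero[of "f 0 0"] a[of 0] norm_ge_zero[of "g 0"]
        mult_nonneg_nonneg[of "spectral_norm A" C] unfolding M_def by linarith
    fix k s t assume st: "\<theta> (k - 1) < s" "s \<le> \<theta> k" "\<theta> (k - 1) < t" "t \<le> \<theta> k"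
    consider "s < t" | "s = t" | "t < s" by linarith
    then show "norm (x s - x t) \<le> M * \<bar>s - t\<bar>"
    proof cases
      case 1
      with *[of k s t] st show ?thesis by (simp add: norm_minus_commute right_diff_distrib)
    next
      case 3
      with *[of k t s] st show ?thesis by (simp add: right_diff_distrib)
    qed simp
  qed
qed

end

section \<open>Unpredictability and stability\<close>

lemma filterlim_of_int_mult_at_top:
  fixes c w :: real
  assumes "filterlim q at_top F" "w > 0"
  shows "filterlim (\<lambda>n. c + of_int (q n) * w) at_top F"
  using assms
  by (intro filterlim_tendsto_add_at_top[OF tendsto_const] filterlim_compose[OF filterlim_real_of_int_at_top]
      filterlim_at_top_mult_tendsto_pos[OF tendsto_const])

context quasilinear_system
begin

text \<open>On a compact set the solution depends, up to \<open>e\<close>, only on the inputs of the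
  last \<tau> time units. These belong to finitely many blocks, over which pointwise convergence of
  the shifted sequence is uniform.\<close>

lemma solution_recurrent:
  assumes sol: "is_solution UNIV (\<lambda>t. \<alpha> (block t)) (\<lambda>_. 0) \<psi>" and bdd: "bounded (range \<psi>)"
    and q: "\<And>k. (\<lambda>n. norm (\<alpha> (k + q n) - \<alpha> k)) \<longlonglongrightarrow> 0" and "compact S"
  shows "uniform_limit S (\<lambda>n t. \<psi> (t + of_int (q n) * \<omega>)) \<psi> sequentially"
proof (rule uniform_limitI)
  fix e :: real assume "e > 0"
  obtain D where D: "D > 0" "\<And>s t. norm (\<psi> s - \<psi> t) \<le> D" using bounded_diff[OF bdd bdd] by blast
  obtain \<tau> \<epsilon> where \<tau>: "\<tau> > 0" "\<epsilon> > 0" and comp: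
    "\<And>t\<^sub>0 T x y g g' \<gamma> \<gamma>'. \<lbrakk>t\<^sub>0 + \<tau> \<le> T; is_solution UNIV g \<gamma> x; is_solution UNIV g' \<gamma>' y;
       \<And>t. norm (x t - y t) \<le> D;
       \<And>t. t\<^sub>0 < t \<Longrightarrow> t \<le> T \<Longrightarrow> norm (g t - g' t) \<le> \<epsilon>;
       \<And>k. t\<^sub>0 < \<theta> k \<Longrightarrow> \<theta> k \<le> T \<Longrightarrow> norm (\<gamma> k - \<gamma>' k) \<le> \<epsilon>\<rbrakk>
       \<Longrightarrow> norm (x T - y T) < e"
    by (rule bounded_solution_comparison[OF \<open>e > 0\<close> D(1)]) blast
  obtain c where c: "\<And>t. t \<in> S \<Longrightarrow> \<bar>t\<bar> \<le> c"
    using compact_imp_bounded[OF \<open>compact S\<close>] by (auto simp: bounded_iff)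
  define t\<^sub>0 where "t\<^sub>0 = - c - \<tau>"
  have "\<forall>\<^sub>F n in sequentially. \<forall>k\<in>{block t\<^sub>0..block c}. norm (\<alpha> (k + q n) - \<alpha> k) < \<epsilon>"
    using order_tendstoD(2)[OF q \<tau>(2)] by (intro eventually_ball_finite) auto
  then show "\<forall>\<^sub>F n in sequentially. \<forall>T\<in>S. dist (\<psi> (T + of_int (q n) * \<omega>)) (\<psi> T) < e"
  proof eventually_elim
    case (elim n)
    show ?case
    proof
      fix T assume "T \<in> S"
      then have T: "t\<^sub>0 + \<tau> \<le> T" "T \<le> c" using c[of T] by (auto simp: t\<^sub>0_def)
      have "norm (\<psi> (T + of_int (q n) * \<omega>) - \<psi> T) < e"
      proof (rule comp[OF T(1) solution_shift[OF sol] sol])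
        fix t assume "t\<^sub>0 < t" "t \<le> T"
        then have "block t \<in> {block t\<^sub>0..block c}" using block_mono T(2) by auto
        with elim show "norm (\<alpha> (block (t + of_int (q n) * \<omega>)) - \<alpha> (block t)) \<le> \<epsilon>"
          by (auto simp: block_shift intro: less_imp_le)
      qed (use D \<tau> in auto)
      then show "dist (\<psi> (T + of_int (q n) * \<omega>)) (\<psi> T) < e" by (simp add: dist_norm)
    qed
  qed
qed

text \<open>On the first segment of the block \<open>r\<close> the difference \<open>d\<close> of the shifted and the original
  solution satisfies \<open>d' = c + O(\<bar>d\<bar>)\<close> with the constant vector \<open>c = \<alpha> (q + r) - \<alpha> r\<close>, so that
  \<open>d\<close> cannot stay small there.\<close>

lemma solution_separated:
  assumes sol: "is_solution UNIV (\<lambda>t. \<alpha> (block t)) (\<lambda>_. 0) \<psi>" and bdd: "bounded (range \<psi>)"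
    "bounded (range \<alpha>)" and \<upsilon>: "\<upsilon> > 0"
  obtains \<epsilon>\<^sub>0 \<nu> where "\<epsilon>\<^sub>0 > 0" "\<nu> > 0" "\<And>q r. norm (\<alpha> (q + r) - \<alpha> r) \<ge> \<upsilon> \<Longrightarrow>
    \<exists>\<tau>\<ge>\<theta> (r * int p). \<forall>t\<in>{\<tau> - \<nu>..\<tau> + \<nu>}. norm (\<psi> (t + of_int q * \<omega>) - \<psi> t) \<ge> \<epsilon>\<^sub>0"
proof -
  have "bounded (range (\<lambda>t. \<alpha> (block t)))" using block_BPC[OF bdd(2)] by (simp add: BPC_def)
  from solution_lipschitz[OF sol bdd(1) this] obtain M where M: "M > 0"
    "\<And>k s t. \<theta> (k - 1) < s \<Longrightarrow> s \<le> \<theta> k \<Longrightarrow> \<theta> (k - 1) < t \<Longrightarrow> t \<le> \<theta> k \<Longrightarrow>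
      norm (\<psi> s - \<psi> t) \<le> M * \<bar>s - t\<bar>" by blast
  \<comment> \<open>Half the length of the first segment of a block, which is the same for every
    block.\<close>
  define l where "l = (\<theta> 1 - \<theta> 0) / 2"
  have l: "l > 0" by (simp add: l_def less_iff)
  have A: "0 \<le> spectral_norm A" unfolding spectral_norm_def by (rule onorm_pos_le) simp
  \<comment> \<open>If \<open>d\<close> stayed below \<epsilon> in norm for a time \<open>l\<close>,
    integration would give \<open>l * norm c \<le> Q * \<epsilon>\<close>. The choice of \<epsilon>
    makes the right side \<open>l * \<upsilon> / 2\<close>, a contradiction.\<close>
  define Q where "Q = 2 + (spectral_norm A + Lf) * l"
  define \<epsilon> where "\<epsilon> = l * \<upsilon> / (2 * Q)"
  have Q: "Q > 0" using A Lf_pos l by (simp add: Q_def add_pos_nonneg)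
  then have \<epsilon>: "\<epsilon> > 0" using l \<upsilon> by (simp add: \<epsilon>_def)
  have "Q * \<epsilon> = l * \<upsilon> / 2" using Q by (simp add: \<epsilon>_def)
  moreover have "l * \<upsilon> > 0" using l \<upsilon> by simp
  moreover have "Q * \<epsilon> = 2 * \<epsilon> + (spectral_norm A + Lf) * \<epsilon> * l"
    by (simp add: Q_def algebra_simps)
  ultimately have small: "2 * \<epsilon> + (spectral_norm A + Lf) * \<epsilon> * l < l * \<upsilon>" by linarith
  \<comment> \<open>A window of length \<open>2 * \<nu>\<close> has to fit into half a segment, and
    \<open>d\<close>, which has Lipschitz constant \<open>2 * M\<close>, may change on it by at most
    \<open>\<epsilon> / 2\<close>.\<close>
  define \<nu> where "\<nu> = min (l / 4) (\<epsilon> / (8 * M))"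
  have \<nu>: "\<nu> > 0" "2 * \<nu> < l" "2 * M * (2 * \<nu>) \<le> \<epsilon> / 2"
    using l \<epsilon> M(1) by (auto simp: \<nu>_def min_def field_simps)
  have "\<exists>\<tau>\<ge>\<theta> (r * int p). \<forall>t\<in>{\<tau> - \<nu>..\<tau> + \<nu>}. norm (\<psi> (t + of_int q * \<omega>) - \<psi> t) \<ge> \<epsilon> / 2"
    if c: "norm (\<alpha> (q + r) - \<alpha> r) \<ge> \<upsilon>" for q r
  proof -
    let ?c = "\<alpha> (q + r) - \<alpha> r"
    define d where "d t = \<psi> (t + of_int q * \<omega>) - \<psi> t" for t
    define k where "k = r * int p + 1"
    define a where "a = \<theta> (k - 1)"
    define b where "b = \<theta> k"
    have ab: "b - a = 2 * l" "a = \<theta> (r * int p)"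
      using shift[of 0 r] shift[of 1 r] by (simp_all add: a_def b_def k_def l_def add.commute)
    have block_r: "block t = r" "block (t + of_int q * \<omega>) = q + r" if "a < t" "t \<le> b" for t
      using block_eqI[of k t] that p_pos by (simp_all add: block_shift a_def b_def k_def)
    have d_deriv: "(d has_vector_derivative A *v d t
        + ((f t (\<psi> (t + of_int q * \<omega>)) - f t (\<psi> t)) + ?c)) (at t)" if "a < t" "t < b" for t
    proof -
      have "t \<notin> range \<theta>" using not_moment[of k t] that by (simp add: a_def b_def)
      then show ?thesis
        using impulsive_solution_on_deriv[OF solution_diff[OF solution_shift[OF sol] sol], of t q]
          block_r[of t] that by (simp add: d_def[abs_def] algebra_simps)
    qed
    have d_lip: "norm (d s - d t) \<le> 2 * M * \<bar>s - t\<bar>" if "a < s" "s \<le> b" "a < t" "t \<le> b" for s t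
    proof -
      have "norm (\<psi> (s + of_int q * \<omega>) - \<psi> (t + of_int q * \<omega>)) \<le> M * \<bar>(s + of_int q * \<omega>) - (t + of_int q * \<omega>)\<bar>"
        by (rule M(2)[of "k + q * int p"])
          (use that shift[of k q] shift[of "k - 1" q] in \<open>auto simp: a_def b_def algebra_simps\<close>)
      moreover have "norm (\<psi> s - \<psi> t) \<le> M * \<bar>s - t\<bar>"
        by (rule M(2)[of k]) (use that in \<open>auto simp: a_def b_def\<close>)
      moreover have "d s - d t = (\<psi> (s + of_int q * \<omega>) - \<psi> (t + of_int q * \<omega>)) - (\<psi> s - \<psi> t)"
        by (simp add: d_def)
      ultimately show ?thesis
        using norm_triangle_ineq4[of "\<psi> (s + of_int q * \<omega>) - \<psi> (t + of_int q * \<omega>)" "\<psi> s - \<psi> t"] by simp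
    qed
    \<comment> \<open>The time is sought in the second half of the segment to leave room on its left
      for the window.\<close>
    obtain s where s: "b - l \<le> s" "s \<le> b" "norm (d s) \<ge> \<epsilon>"
    proof (rule ccontr)
      assume "\<not> thesis"
      with that have d_small: "norm (d s) < \<epsilon>" if "b - l \<le> s" "s \<le> b" for s
        using that by (meson not_le)
      have "norm ((d b - b *\<^sub>R ?c) - (d (b - l) - (b - l) *\<^sub>R ?c))
          \<le> (spectral_norm A + Lf) * \<epsilon> * b - (spectral_norm A + Lf) * \<epsilon> * (b - l)"
      proof (rule differentiable_bound_general)
        show "b - l < b" using l by simp
        have "(2 * M)-lipschitz_on {b - l..b} d"
          using d_lip M(1) ab l by (intro lipschitz_onI) (auto simp: dist_norm dist_real_def)
        then have "continuous_on {b - l..b} d" by (rule lipschitz_on_continuous_on)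
        then show "continuous_on {b - l..b} (\<lambda>t. d t - t *\<^sub>R ?c)" by (intro continuous_intros)
        show "continuous_on {b - l..b} (\<lambda>t. (spectral_norm A + Lf) * \<epsilon> * t)" by (intro continuous_intros)
        fix t assume t: "b - l < t" "t < b"
        then have t': "a < t" "t < b" using ab l by auto
        show "((\<lambda>t. d t - t *\<^sub>R ?c) has_vector_derivative
            A *v d t + (f t (\<psi> (t + of_int q * \<omega>)) - f t (\<psi> t))) (at t)"
          by (rule derivative_eq_intros d_deriv[OF t'] refl)+ simp
        show "((\<lambda>t. (spectral_norm A + Lf) * \<epsilon> * t) has_vector_derivative (spectral_norm A + Lf) * \<epsilon>) (at t)"
          unfolding has_real_derivative_iff_has_vector_derivative[symmetric]
          by (rule derivative_eq_intros refl)+ simp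
        have "norm (A *v d t + (f t (\<psi> (t + of_int q * \<omega>)) - f t (\<psi> t)))
            \<le> spectral_norm A * norm (d t) + Lf * norm (d t)"
          unfolding d_def by (intro norm_triangle_le add_mono norm_matrix_vector_mult_le f_lip)
        also have "\<dots> = (spectral_norm A + Lf) * norm (d t)" by (simp add: distrib_right)
        also have "\<dots> \<le> (spectral_norm A + Lf) * \<epsilon>"
          using A Lf_pos d_small[of t] t by (intro mult_left_mono) auto
        finally show "norm (A *v d t + (f t (\<psi> (t + of_int q * \<omega>)) - f t (\<psi> t)))
            \<le> (spectral_norm A + Lf) * \<epsilon>" .
      qed
      also have "(d b - b *\<^sub>R ?c) - (d (b - l) - (b - l) *\<^sub>R ?c) = (d b - d (b - l)) - l *\<^sub>R ?c"
        by (simp add: algebra_simps)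
      finally have "norm ((d b - d (b - l)) - l *\<^sub>R ?c) \<le> (spectral_norm A + Lf) * \<epsilon> * l"
        by (simp add: algebra_simps)
      moreover have "norm (d b - d (b - l)) \<le> 2 * \<epsilon>"
        using norm_triangle_ineq4[of "d b" "d (b - l)"] d_small[of b] d_small[of "b - l"] l by simp
      moreover have "l * norm ?c \<le> norm (d b - d (b - l)) + norm ((d b - d (b - l)) - l *\<^sub>R ?c)"
        using norm_triangle_ineq4[of "d b - d (b - l)" "(d b - d (b - l)) - l *\<^sub>R ?c"] l by simp
      moreover have "l * \<upsilon> \<le> l * norm ?c" using c l by simp
      ultimately show False using small by linarith
    qed
    \<comment> \<open>The window is centred at \<open>s - \<nu>\<close> and thus ends at
      \<open>s\<close>: it stays within the segment even if \<open>s\<close> is the right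
      end.\<close>
    show ?thesis
    proof (intro exI[of _ "s - \<nu>"] conjI ballI)
      show "\<theta> (r * int p) \<le> s - \<nu>" using s ab l \<nu> by simp
      fix t assume t: "t \<in> {s - \<nu> - \<nu>..s - \<nu> + \<nu>}"
      have "norm (d s - d t) \<le> 2 * M * \<bar>s - t\<bar>" using t s ab l \<nu> by (intro d_lip) auto
      also have "\<dots> \<le> 2 * M * (2 * \<nu>)" using t M(1) \<nu> by (intro mult_left_mono) auto
      finally have "norm (d s - d t) \<le> \<epsilon> / 2" using \<nu> by simp
      then have "norm (d t) \<ge> \<epsilon> / 2" using s(3) norm_triangle_ineq2[of "d s" "d t"] by simp
      then show "norm (\<psi> (t + of_int q * \<omega>) - \<psi> t) \<ge> \<epsilon> / 2" by (simp add: d_def)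
    qed
  qed
  with \<epsilon> \<nu>(1) show thesis by (intro that[of "\<epsilon> / 2" \<nu>]) auto
qed

text \<open>Index shifts \<open>q n\<close> become time shifts \<open>q n * \<omega>\<close>. The
  windows lie in the first segments of the blocks \<open>r n\<close> and so move to infinity; that
  their size is the same for all \<open>n\<close> comes from
  \<open>solution_separated\<close>.\<close>

lemma solution_unpredictable:
  assumes sol: "is_solution UNIV (\<lambda>t. \<alpha> (block t)) (\<lambda>_. 0) \<psi>" and bdd: "bounded (range \<psi>)"
    and \<alpha>: "unpredictable_seq \<alpha>"
  shows "unpredictable \<theta> \<psi>"
proof -
  obtain \<upsilon> q r where \<upsilon>: "\<upsilon> > 0" and q: "filterlim q at_top sequentially"
    "\<And>a b k. k \<in> {a..b} \<Longrightarrow> (\<lambda>n. norm (\<alpha> (k + q n) - \<alpha> k)) \<longlonglongrightarrow> 0"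
    and r: "filterlim r at_top sequentially" "\<And>n::nat. norm (\<alpha> (q n + r n) - \<alpha> (r n)) \<ge> \<upsilon>"
    and \<alpha>_bdd: "bounded (range \<alpha>)"
    using \<alpha> unfolding unpredictable_seq_def by blast
  have q': "(\<lambda>n. norm (\<alpha> (k + q n) - \<alpha> k)) \<longlonglongrightarrow> 0" for k
    by (rule q(2)[of k k k]) simp
  define \<mu> where "\<mu> n = of_int (q n) * \<omega>" for n
  have \<mu>: "filterlim \<mu> at_top sequentially"
    using filterlim_of_int_mult_at_top[OF q(1) \<omega>_pos, of 0] by (simp add: \<mu>_def[abs_def])
  obtain \<epsilon>\<^sub>0 \<nu> where sep: "\<epsilon>\<^sub>0 > 0" "\<nu> > 0" "\<And>q r. norm (\<alpha> (q + r) - \<alpha> r) \<ge> \<upsilon> \<Longrightarrow>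
    \<exists>\<tau>\<ge>\<theta> (r * int p). \<forall>t\<in>{\<tau> - \<nu>..\<tau> + \<nu>}. norm (\<psi> (t + of_int q * \<omega>) - \<psi> t) \<ge> \<epsilon>\<^sub>0"
    by (rule solution_separated[OF sol bdd \<alpha>_bdd \<upsilon>]) blast
  obtain \<tau> where \<tau>: "\<And>n. \<tau> n \<ge> \<theta> (r n * int p)"
    "\<And>n t. t \<in> {\<tau> n - \<nu>..\<tau> n + \<nu>} \<Longrightarrow> norm (\<psi> (t + \<mu> n) - \<psi> t) \<ge> \<epsilon>\<^sub>0"
    using sep(3)[OF r(2)] unfolding \<mu>_def by metis
  have "filterlim (\<lambda>n. \<theta> (r n * int p)) at_top sequentially"
    using filterlim_of_int_mult_at_top[OF r(1) \<omega>_pos, of "\<theta> 0"] shift[of 0] by simp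
  then have \<tau>': "filterlim \<tau> at_top sequentially"
    by (rule filterlim_at_top_mono) (use \<tau>(1) in auto)
  have "bounded (range (\<lambda>t. \<alpha> (block t)))" using block_BPC[OF \<alpha>_bdd] by (simp add: BPC_def)
  from solution_lipschitz[OF sol bdd this] obtain M where M: "M > 0"
    "\<And>k s t. \<theta> (k - 1) < s \<Longrightarrow> s \<le> \<theta> k \<Longrightarrow> \<theta> (k - 1) < t \<Longrightarrow> t \<le> \<theta> k \<Longrightarrow>
      norm (\<psi> s - \<psi> t) \<le> M * \<bar>s - t\<bar>" by blast
  have unif: "\<exists>\<delta>>0. \<forall>k. \<forall>s\<in>{\<theta> (k - 1)<..\<theta> k}. \<forall>t\<in>{\<theta> (k - 1)<..\<theta> k}.
      \<bar>s - t\<bar> < \<delta> \<longrightarrow> norm (\<psi> s - \<psi> t) < \<epsilon>" if "\<epsilon> > 0" for \<epsilon>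
  proof (intro exI[of _ "\<epsilon> / M"] conjI allI ballI impI)
    fix k s t assume st: "s \<in> {\<theta> (k - 1)<..\<theta> k}" "t \<in> {\<theta> (k - 1)<..\<theta> k}" "\<bar>s - t\<bar> < \<epsilon> / M"
    then have "norm (\<psi> s - \<psi> t) \<le> M * \<bar>s - t\<bar>" by (intro M(2)[of k]) auto
    also have "\<dots> < \<epsilon>" using st(3) M(1) by (simp add: pos_less_divide_eq mult.commute)
    finally show "norm (\<psi> s - \<psi> t) < \<epsilon>" .
  qed (use that M in auto)
  have recur: "uniform_limit S (\<lambda>n t. \<psi> (t + \<mu> n)) \<psi> sequentially" if "compact S" for S
    unfolding \<mu>_def by (rule solution_recurrent[OF sol bdd q' that])
  show ?thesis
    unfolding unpredictable_def using solution_BPC[OF sol bdd]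
    by (intro conjI exI[of _ \<epsilon>\<^sub>0] exI[of _ \<nu>] exI[of _ \<mu>] exI[of _ \<tau>] allI impI ballI
        sep \<mu> \<tau>' unif recur \<tau>(2))
qed

text \<open>If \<open>t\<^sub>0\<close> is a moment, the jump at \<open>t\<^sub>0\<close> is carried
  out at once, and the comparison starts from the state after it. The factor
  \<open>1 + spectral_norm B + Lh\<close> covers that jump, and trivially a start between
  moments.\<close>

lemma solution_diff_right:
  assumes x: "is_solution UNIV g \<gamma> x" and y: "is_solution {t\<^sub>0..} g \<gamma> y"
  obtains d where "((\<lambda>t. y t - x t) \<longlongrightarrow> d) (at_right t\<^sub>0)"
    "norm d \<le> (1 + spectral_norm B + Lh) * norm (y t\<^sub>0 - x t\<^sub>0)"
proof -
  have Bn: "0 \<le> spectral_norm B" unfolding spectral_norm_def by (rule onorm_pos_le) simp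
  note diff = impulsive_solution_on_diff[OF y impulsive_solution_on_subset[OF x subset_UNIV]]
  show thesis
  proof (cases "t\<^sub>0 \<in> range \<theta>")
    case False
    with diff have "((\<lambda>t. y t - x t) \<longlongrightarrow> y t\<^sub>0 - x t\<^sub>0) (at t\<^sub>0 within {t\<^sub>0..})"
      unfolding impulsive_solution_on_def
      by (auto dest!: has_vector_derivative_continuous simp: continuous_within)
    then have "((\<lambda>t. y t - x t) \<longlongrightarrow> y t\<^sub>0 - x t\<^sub>0) (at_right t\<^sub>0)"
      by (rule tendsto_within_subset) auto
    moreover have "1 * norm (y t\<^sub>0 - x t\<^sub>0) \<le> (1 + spectral_norm B + Lh) * norm (y t\<^sub>0 - x t\<^sub>0)"
      using Bn Lh_pos by (intro mult_right_mono) auto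
    ultimately show thesis by (intro that) auto
  next
    case True
    then obtain k where k: "t\<^sub>0 = \<theta> k" by auto
    let ?d = "y t\<^sub>0 - x t\<^sub>0"
    obtain r where r: "((\<lambda>t. y t - x t) \<longlongrightarrow> r) (at_right t\<^sub>0)"
      "r - ?d = B *v ?d + (h (y t\<^sub>0) + \<gamma> k - (h (x t\<^sub>0) + \<gamma> k))"
      using diff unfolding impulsive_solution_on_def k by auto
    have "r = ?d + (B *v ?d + (h (y t\<^sub>0) - h (x t\<^sub>0)))" using r(2) by (simp add: algebra_simps)
    also have "norm \<dots> \<le> norm ?d + (spectral_norm B * norm ?d + Lh * norm ?d)"
      by (intro norm_triangle_le add_mono order_refl norm_matrix_vector_mult_le h_lip)
    finally have "norm r \<le> (1 + spectral_norm B + Lh) * norm ?d" by (simp add: algebra_simps)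
    with r(1) show thesis by (rule that)
  qed
qed

text \<open>Two solutions with the same inputs have no input error between them, so
  \<open>comparison\<close> yields pure exponential decay; stability and attraction are both read
  off from \<open>est\<close>.\<close>

lemma solution_asymptotically_stable:
  assumes x: "is_solution UNIV g \<gamma> x"
  shows "asymptotically_stable \<theta> (\<lambda>t x. A *v x + (f t x + g t)) (\<lambda>k x. B *v x + (h x + \<gamma> k)) x"
proof -
  obtain K \<eta> where K: "K > 0" "\<eta> > 0" and comp:
    "\<And>t\<^sub>0 T x y g g' \<gamma> \<gamma>' u \<epsilon> d\<^sub>0. \<lbrakk>t\<^sub>0 < T; is_solution {t\<^sub>0<..} g \<gamma> x; is_solution {t\<^sub>0<..} g' \<gamma>' y;
       ((\<lambda>t. x t - y t) \<longlongrightarrow> d\<^sub>0) (at_right t\<^sub>0); norm d\<^sub>0 \<le> u; u > 0; \<epsilon> \<ge> 0;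
       \<And>t. t\<^sub>0 < t \<Longrightarrow> t \<le> T \<Longrightarrow> norm (g t - g' t) \<le> \<epsilon>;
       \<And>k. t\<^sub>0 < \<theta> k \<Longrightarrow> \<theta> k \<le> T \<Longrightarrow> norm (\<gamma> k - \<gamma>' k) \<le> \<epsilon>\<rbrakk>
       \<Longrightarrow> norm (x T - y T) \<le> K * (exp (- \<eta> * (T - t\<^sub>0)) * u + \<epsilon>)"
    by (rule solution_comparison) blast
  define K' where "K' = 1 + spectral_norm B + Lh"
  have "0 \<le> spectral_norm B" unfolding spectral_norm_def by (rule onorm_pos_le) simp
  then have K': "K' > 0" using Lh_pos by (simp add: K'_def)
  have est: "norm (y T - x T) \<le> K * K' * \<delta> * exp (- \<eta> * (T - t\<^sub>0))"
    if y: "is_solution {t\<^sub>0..} g \<gamma> y" and \<delta>: "norm (y t\<^sub>0 - x t\<^sub>0) < \<delta>" and T: "t\<^sub>0 < T"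
    for y t\<^sub>0 T \<delta>
  proof -
    obtain d where d: "((\<lambda>t. y t - x t) \<longlongrightarrow> d) (at_right t\<^sub>0)" "norm d \<le> K' * norm (y t\<^sub>0 - x t\<^sub>0)"
      using solution_diff_right[OF x y] unfolding K'_def by blast
    have "norm d \<le> K' * \<delta>" by (rule order_trans[OF d(2)]) (use \<delta> K' in auto)
    moreover have "\<delta> > 0" using \<delta> norm_ge_zero order_le_less_trans by blast
    ultimately have "norm (y T - x T) \<le> K * (exp (- \<eta> * (T - t\<^sub>0)) * (K' * \<delta>) + 0)"
      using K' by (intro comp[OF T impulsive_solution_on_subset[OF y]
            impulsive_solution_on_subset[OF x subset_UNIV] d(1)]) auto
    then show ?thesis by (simp add: mult_ac)
  qed
  show ?thesis
    unfolding asymptotically_stable_def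
  proof (intro conjI allI impI)
    fix t\<^sub>0 \<epsilon> :: real assume "\<epsilon> > 0"
    \<comment> \<open>The minimum with \<epsilon> serves \<open>t = t\<^sub>0\<close>, which the
      estimate for later times does not reach.\<close>
    define \<delta> where "\<delta> = min \<epsilon> (\<epsilon> / (2 * (K * K')))"
    have \<delta>: "\<delta> > 0" "\<delta> \<le> \<epsilon>" "K * K' * \<delta> < \<epsilon>"
      using K K' \<open>\<epsilon> > 0\<close> by (auto simp: \<delta>_def min_def field_simps)
    have "norm (y t - x t) < \<epsilon>"
      if y: "is_solution {t\<^sub>0..} g \<gamma> y" "norm (y t\<^sub>0 - x t\<^sub>0) < \<delta>" and t: "t \<ge> t\<^sub>0" for y t
    proof (cases "t = t\<^sub>0")
      case True
      then show ?thesis using y(2) \<delta> by simp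
    next
      case False
      have "norm (y t - x t) \<le> K * K' * \<delta> * exp (- \<eta> * (t - t\<^sub>0))" using False t by (intro est y) auto
      also have "\<dots> \<le> K * K' * \<delta> * 1" using K K' \<delta> t by (intro mult_left_mono) auto
      finally show ?thesis using \<delta> by simp
    qed
    then show "\<exists>\<delta>>0. \<forall>y. is_solution {t\<^sub>0..} g \<gamma> y \<and> norm (y t\<^sub>0 - x t\<^sub>0) < \<delta> \<longrightarrow>
        (\<forall>t\<ge>t\<^sub>0. norm (y t - x t) < \<epsilon>)"
      using \<delta>(1) by blast
  next
    fix t\<^sub>0 :: real
    \<comment> \<open>The radius 1 is arbitrary, as \<open>est\<close> holds for every initial
      distance.\<close>
    have "((\<lambda>t. norm (y t - x t)) \<longlongrightarrow> 0) at_top"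
      if y: "is_solution {t\<^sub>0..} g \<gamma> y" "norm (y t\<^sub>0 - x t\<^sub>0) < 1" for y
    proof (rule tendstoI)
      fix e :: real assume "e > 0"
      have "K * K' * 1 > 0" using K K' by simp
      from exp_decay[OF this K(2) \<open>e > 0\<close>] obtain \<tau>\<^sub>0
        where \<tau>: "\<And>\<tau>. \<tau> \<ge> \<tau>\<^sub>0 \<Longrightarrow> K * K' * 1 * exp (- \<eta> * \<tau>) < e" by blast
      have "dist (norm (y T - x T)) 0 < e" if "T \<ge> t\<^sub>0 + max 1 \<tau>\<^sub>0" for T
      proof -
        have "t\<^sub>0 < T" "T - t\<^sub>0 \<ge> \<tau>\<^sub>0" using that by auto
        from est[OF y this(1)] \<tau>[OF this(2)] have "norm (y T - x T) < e" by linarith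
        then show ?thesis by simp
      qed
      then show "\<forall>\<^sub>F T in at_top. dist (norm (y T - x T)) 0 < e" by (rule eventually_at_top_linorderI)
    qed
    then show "\<exists>\<delta>>0. \<forall>y. is_solution {t\<^sub>0..} g \<gamma> y \<and> norm (y t\<^sub>0 - x t\<^sub>0) < \<delta> \<longrightarrow>
        ((\<lambda>t. norm (y t - x t)) \<longlongrightarrow> 0) at_top"
      using zero_less_one by blast
  qed
qed

end

theorem theorem3p1:
  fixes p :: nat
    and \<omega> Mf Mh Lf Lh N lam :: real
    and \<theta> :: "int \<Rightarrow> real"
    and A B :: "real^'m^'m"
    and f :: "real \<Rightarrow> real^'m \<Rightarrow> real^'m"
    and h :: "real^'m \<Rightarrow> real^'m"
    and \<gamma> \<sigma> :: "int \<Rightarrow> real^'m"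
    and g1 g2 :: "real \<Rightarrow> real^'m"
  assumes "p \<ge> 1" and "\<omega> > 0" and "\<theta> \<in> impulse_moments p \<omega>"
    and "A ** B = B ** A"
    and "continuous_on UNIV (\<lambda>(t, x). f t x)"
    and "continuous_on UNIV h"
    and "bounded (range \<gamma>)" and "((\<lambda>k. norm (\<gamma> k)) \<longlongrightarrow> 0) at_top"
    and "bounded (range \<sigma>)"
    and "g1 \<in> BPC \<theta>"
    and "\<And>k t. \<theta> (k * int p) < t \<Longrightarrow> t \<le> \<theta> ((k + 1) * int p) \<Longrightarrow> g1 t = \<sigma> k"
    and "g2 \<in> BPC \<theta>" and "((\<lambda>t. norm (g2 t)) \<longlongrightarrow> 0) at_top"
    and "det (mat 1 + B) \<noteq> 0"
    and "\<And>z. eigenvalue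
           (complex_matrix A + (real p / \<omega>) *\<^sub>R matrix_Log (complex_matrix (mat 1 + B))) z
           \<Longrightarrow> Re z < 0"
    and "\<And>t x. f (t + \<omega>) x = f t x"
    and "Mf > 0" and "\<And>t x. t \<in> {0..<\<omega>} \<Longrightarrow> norm (f t x) \<le> Mf"
    and "Mh > 0" and "\<And>x. norm (h x) \<le> Mh"
    and "Lf > 0" and "\<And>t x1 x2. norm (f t x1 - f t x2) \<le> Lf * norm (x1 - x2)"
    and "Lh > 0" and "\<And>x1 x2. norm (h x1 - h x2) \<le> Lh * norm (x1 - x2)"
    and "N \<ge> 1" and "lam > 0"
    and "\<And>t s. s \<le> t \<Longrightarrow> spectral_norm (matriciant A B \<theta> t s) \<le> N * exp (- lam * (t - s))"
    and "N * (Lf / lam + real p * Lh / (1 - exp (- lam * \<omega>))) < 1"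
    and "N * Lf + (real p / \<omega>) * ln (1 + N * Lh) < lam"
    and "Lh * spectral_norm (matrix_inv (mat 1 + B)) < 1"
    and "asymptotically_unpredictable_seq \<sigma>"
  shows "let F = (\<lambda>t x. A *v x + f t x + g1 t + g2 t);
             G = (\<lambda>k x. B *v x + h x + \<gamma> k)
         in (\<exists>!x. impulsive_solution_on UNIV \<theta> F G x \<and> asymptotically_unpredictable \<theta> x) \<and>
            (\<forall>x. impulsive_solution_on UNIV \<theta> F G x \<and> asymptotically_unpredictable \<theta> x
               \<longrightarrow> asymptotically_stable \<theta> F G x)"
proof -
  interpret quasilinear_system p \<omega> \<theta> A B N lam Lf Lh f h Mf Mh
    using assms by unfold_locales auto
  define g where "g t = g1 t + g2 t" for t
  obtain \<alpha> \<beta> where \<alpha>: "unpredictable_seq \<alpha>" and \<beta>: "((\<lambda>k. norm (\<beta> k)) \<longlongrightarrow> 0) at_top"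
    and \<sigma>: "\<And>k. \<sigma> k = \<alpha> k + \<beta> k"
    using \<open>asymptotically_unpredictable_seq \<sigma>\<close> unfolding asymptotically_unpredictable_seq_def by blast
  have \<alpha>_bdd: "bounded (range \<alpha>)" using \<alpha> by (simp add: unpredictable_seq_def)
  have g_BPC: "g \<in> BPC \<theta>"
    unfolding g_def by (rule BPC_add) (fact \<open>g1 \<in> BPC \<theta>\<close> \<open>g2 \<in> BPC \<theta>\<close>)+
  \<comment> \<open>What separates the given input from the purely unpredictable one fades away:
    \<open>\<beta> (block t)\<close> because block numbers tend to infinity with \<open>t\<close>,
    and \<open>g2\<close> by assumption.\<close>
  have g_diff: "g t - \<alpha> (block t) = \<beta> (block t) + g2 t" for t
    using assms(11)[OF block] by (simp add: g_def \<sigma>)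
  have g_lim: "((\<lambda>t. norm (g t - \<alpha> (block t))) \<longlongrightarrow> 0) at_top"
    unfolding g_diff
  proof (rule tendsto_norm_zero, rule tendsto_add_zero)
    show "((\<lambda>t. \<beta> (block t)) \<longlongrightarrow> 0) at_top"
      using filterlim_compose[OF tendsto_norm_zero_cancel[OF \<beta>] block_at_top] .
    show "(g2 \<longlongrightarrow> 0) at_top"
      using \<open>((\<lambda>t. norm (g2 t)) \<longlongrightarrow> 0) at_top\<close> by (rule tendsto_norm_zero_cancel)
  qed
  obtain x where x: "is_solution UNIV g \<gamma> x" "bounded (range x)"
    using bounded_solution_exists[OF g_BPC \<open>bounded (range \<gamma>)\<close>] by blast
  obtain \<psi> where \<psi>: "is_solution UNIV (\<lambda>t. \<alpha> (block t)) (\<lambda>_. 0) \<psi>" "bounded (range \<psi>)"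
    using bounded_solution_exists[OF block_BPC[OF \<alpha>_bdd], of "\<lambda>_. 0"] by auto
  have "((\<lambda>t. norm (x t - \<psi> t)) \<longlongrightarrow> 0) at_top"
    by (rule bounded_solution_diff_tendsto_0[OF x \<psi> g_lim]) (use assms(8) in simp)
  moreover have "(\<lambda>t. x t - \<psi> t) \<in> BPC \<theta>"
    by (intro BPC_diff solution_BPC[OF x] solution_BPC[OF \<psi>])
  ultimately have x_au: "asymptotically_unpredictable \<theta> x"
    unfolding asymptotically_unpredictable_def
    using solution_BPC[OF x] solution_unpredictable[OF \<psi> \<alpha>]
    by (intro conjI exI[of _ \<psi>] exI[of _ "\<lambda>t. x t - \<psi> t"]) auto
  \<comment> \<open>Functions in \<open>BPC \<theta>\<close> are bounded, so uniqueness among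
    bounded solutions is enough.\<close>
  have unique: "y = x" if "is_solution UNIV g \<gamma> y" "asymptotically_unpredictable \<theta> y" for y
    using that x by (intro bounded_solution_unique)
      (auto simp: asymptotically_unpredictable_def BPC_def)
  have F: "(\<lambda>t x. A *v x + f t x + g1 t + g2 t) = (\<lambda>t x. A *v x + (f t x + g t))"
    and G: "(\<lambda>k x. B *v x + h x + \<gamma> k) = (\<lambda>k x. B *v x + (h x + \<gamma> k))"
    by (simp_all add: g_def add.assoc)
  show ?thesis
    unfolding Let_def F G using x(1) x_au unique solution_asymptotically_stable by blast
qed


end
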